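(* If $\mathbf Y=\mathbf H(\mathcal Z,\mathbf Y)$ is well founded, where $\mathbf H$ is a constructible species, then it defines a species whose exponential and ordinary generating series are analytic in a neighborhood of the origin.
   Context: Species: functorial assignments of finite sets of structures to tuples of finite sets, up to isomorphism, with sum, product and composition. Basic species: $1$, $\mathcal Z$ (singletons), $+$, $\cdot$ (as 2-sort species), $\textsc{Seq}$ (linear orders), $\textsc{Set}$ ($\textsc{Set}[U]=\{U\}$), $\textsc{Cyc}$ (cyclic orders on nonempty sets), sort variables $\mathcal Y_i$. A \emph{constructible species} is inductively: a basic species; a basic species with a cardinality constraint that is a finite union of intervals; a composition of constructible species; or a solution of a well-founded system with constructible right-hand sides. \emph{Well founded}: the iteration $\mathbf Y^{[0]}=\mathbf 0$, $\mathbf Y^{[n+1]}=\mathbf H(\mathcal Z,\mathbf Y^{[n]})$ is well defined (composition with species having structures on the empty set allowed only in sorts in which $\mathbf H$ has finitely many structures of each total size in the other sorts), converges (for every $p$, eventually isomorphic to the limit on structures of size $\le p$), and its limit — the species defined by the system — has no empty coordinate. Exponential generating series $\sum f_nz^n/n!$ ($f_n$ structures on $\{1..n\}$); ordinary generating series $\sum\tilde f_nz^n$ ($\tilde f_n$ isomorphism classes of structures of size $n$). *)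

theory Defs
  imports "HOL-Analysis.Analysis" "HOL-Combinatorics.Permutations" "HOL-Library.FSet"
begin

section \<open>Species in several sorts\<close>

text \<open>
  A label is a pair of a sort and a name. A tuple \<open>(U\<^sub>0, \<dots>, U\<^sub>k\<^sub>-\<^sub>1)\<close> of finite sets is represented by
  its disjoint union, a finite set of labels whose sorts are smaller than \<open>k\<close>; a tuple of bijections
  is a sort-preserving bijection. Names are natural numbers, so that species are functors on a
  category equivalent to that of all tuples of finite sets and bijections.
  All structures live in one universe of finite nested tuples and sets over labels.
\<close>

type_synonym label = "nat \<times> nat"

datatype 'a struct = Lab 'a | Tup "'a struct list" | Coll "'a struct fset"

definition coll :: "'a struct set \<Rightarrow> 'a struct" where
  "coll X = Coll (Abs_fset X)"

definition label_set :: "nat \<Rightarrow> label set \<Rightarrow> bool" where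
  "label_set k U \<longleftrightarrow> finite U \<and> (\<forall>a\<in>U. fst a < k)"

definition relabeling :: "(label \<Rightarrow> label) \<Rightarrow> label set \<Rightarrow> label set \<Rightarrow> bool" where
  "relabeling \<sigma> U V \<longleftrightarrow> bij_betw \<sigma> U V \<and> (\<forall>a\<in>U. fst (\<sigma> a) = fst a)"

definition std :: "nat \<Rightarrow> (nat \<Rightarrow> nat) \<Rightarrow> label set" where
  "std k n = (SIGMA i:{..<k}. {1..n i})"

text \<open>\<open>transport F U \<sigma>\<close> is the map \<open>F[\<sigma>] : F[U] \<rightarrow> F[V]\<close> for a relabeling \<open>\<sigma>\<close> from \<open>U\<close> to \<open>V\<close>.\<close>

record species =
  structs :: "label set \<Rightarrow> label struct set"
  transport :: "label set \<Rightarrow> (label \<Rightarrow> label) \<Rightarrow> label struct \<Rightarrow> label struct"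

definition is_species :: "nat \<Rightarrow> species \<Rightarrow> bool" where
  "is_species k F \<longleftrightarrow>
     (\<forall>U. label_set k U \<longrightarrow> finite (structs F U)) \<and>
     (\<forall>U V \<sigma>. label_set k U \<longrightarrow> relabeling \<sigma> U V \<longrightarrow>
        (\<forall>s\<in>structs F U. transport F U \<sigma> s \<in> structs F V)) \<and>
     (\<forall>U \<sigma> \<tau>. label_set k U \<longrightarrow> (\<forall>a\<in>U. \<sigma> a = \<tau> a) \<longrightarrow>
        (\<forall>s\<in>structs F U. transport F U \<sigma> s = transport F U \<tau> s)) \<and>
     (\<forall>U. label_set k U \<longrightarrow> (\<forall>s\<in>structs F U. transport F U id s = s)) \<and>
     (\<forall>U V W \<sigma> \<tau>. label_set k U \<longrightarrow> relabeling \<sigma> U V \<longrightarrow> relabeling \<tau> V W \<longrightarrow>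
        (\<forall>s\<in>structs F U. transport F U (\<tau> \<circ> \<sigma>) s = transport F V \<tau> (transport F U \<sigma> s)))"

definition species_iso :: "nat \<Rightarrow> species \<Rightarrow> species \<Rightarrow> bool" where
  "species_iso k F G \<longleftrightarrow>
     (\<exists>\<alpha>. (\<forall>U. label_set k U \<longrightarrow> bij_betw (\<alpha> U) (structs F U) (structs G U)) \<and>
          (\<forall>U V \<sigma>. label_set k U \<longrightarrow> relabeling \<sigma> U V \<longrightarrow>
             (\<forall>s\<in>structs F U. \<alpha> V (transport F U \<sigma> s) = transport G U \<sigma> (\<alpha> U s))))"

definition card_restrict :: "nat set \<Rightarrow> species \<Rightarrow> species" where
  "card_restrict I F = F\<lparr>structs := \<lambda>U. if card U \<in> I then structs F U else {}\<rparr>"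


section \<open>Basic species\<close>

definition zero_sp :: species where
  "zero_sp = \<lparr>structs = \<lambda>U. {}, transport = \<lambda>U. map_struct\<rparr>"

definition one_sp :: species where
  "one_sp = \<lparr>structs = \<lambda>U. if U = {} then {Tup []} else {}, transport = \<lambda>U. map_struct\<rparr>"

definition sort_sp :: "nat \<Rightarrow> species" where
  "sort_sp i = \<lparr>structs = \<lambda>U. {Lab (i, x) |x. U = {(i, x)}}, transport = \<lambda>U. map_struct\<rparr>"

text \<open>The sum and the product are species in the two sorts 0 and 1; the sum and the product of two
  species are obtained from them by composition.\<close>

definition plus_sp :: species where
  "plus_sp = \<lparr>structs = \<lambda>U. {Lab (i, x) |i x. i < 2 \<and> U = {(i, x)}}, transport = \<lambda>U. map_struct\<rparr>"

definition times_sp :: species where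
  "times_sp = \<lparr>structs = \<lambda>U. {Tup [Lab (0, x), Lab (1, y)] |x y. U = {(0, x), (1, y)}},
               transport = \<lambda>U. map_struct\<rparr>"

definition seq_sp :: species where
  "seq_sp = \<lparr>structs = \<lambda>U. {Tup (map Lab xs) |xs. distinct xs \<and> set xs = U},
             transport = \<lambda>U. map_struct\<rparr>"

definition set_sp :: species where
  "set_sp = \<lparr>structs = \<lambda>U. {coll (Lab ` U)}, transport = \<lambda>U. map_struct\<rparr>"

text \<open>A cyclic order is a linear arrangement up to rotation.\<close>

definition cyc_sp :: species where
  "cyc_sp = \<lparr>structs = \<lambda>U. {coll {Tup (map Lab (rotate j xs)) |j. True} |xs.
                              xs \<noteq> [] \<and> distinct xs \<and> set xs = U},
             transport = \<lambda>U. map_struct\<rparr>"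

text \<open>\<open>basic k F\<close>: \<open>F\<close> is a basic species in the sorts \<open>0, \<dots>, k - 1\<close>. In the systems below, sort 0
  is \<open>\<Z>\<close> and sort \<open>i + 1\<close> is the unknown with index \<open>i\<close>.\<close>

inductive basic :: "nat \<Rightarrow> species \<Rightarrow> bool" where
  "basic k one_sp"
| "i < k \<Longrightarrow> basic k (sort_sp i)"
| "basic 2 plus_sp"
| "basic 2 times_sp"
| "basic 1 seq_sp"
| "basic 1 set_sp"
| "basic 1 cyc_sp"

definition finite_union_of_intervals :: "nat set \<Rightarrow> bool" where
  "finite_union_of_intervals I \<longleftrightarrow>
     (\<exists>C. finite C \<and> (\<forall>J\<in>C. \<exists>a b. J = {a..b} \<or> J = {a..}) \<and> I = \<Union>C)"


section \<open>Composition\<close>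

text \<open>
  The composition \<open>F(G\<^sub>0, \<dots>, G\<^sub>k\<^sub>-\<^sub>1)\<close>: a structure on \<open>U\<close> consists of an \<open>F\<close>-structure \<open>f\<close> on a tuple of
  index sets, a decomposition of \<open>U\<close> into disjoint blocks \<open>B a\<close> given by the indices \<open>a\<close>, and for
  every index \<open>a\<close> of sort \<open>i\<close> a \<open>G\<^sub>i\<close>-structure \<open>g a\<close> on \<open>B a\<close>, all this up to renaming of the indices.
  If no \<open>G\<^sub>i\<close> has a structure on the empty set, then the blocks are nonempty and can serve as
  their own indices, which gives the usual sum over partitions of \<open>U\<close>. Otherwise there may be
  empty blocks; e.g. there is just one structure in the composition of two-element sets with \<open>1\<close>.
\<close>

definition assembly ::
  "nat \<Rightarrow> species \<Rightarrow> (nat \<Rightarrow> species) \<Rightarrow> label set \<Rightarrow>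
   (nat \<Rightarrow> nat) \<Rightarrow> label struct \<Rightarrow> (label \<Rightarrow> label set) \<Rightarrow> (label \<Rightarrow> label struct) \<Rightarrow> bool" where
  "assembly k F G U n f B g \<longleftrightarrow>
     f \<in> structs F (std k n) \<and>
     disjoint_family_on B (std k n) \<and> (\<Union>a\<in>std k n. B a) = U \<and>
     (\<forall>a\<in>std k n. g a \<in> structs (G (fst a)) (B a))"

definition assembly_class ::
  "nat \<Rightarrow> species \<Rightarrow>
   (nat \<Rightarrow> nat) \<Rightarrow> label struct \<Rightarrow> (label \<Rightarrow> label set) \<Rightarrow> (label \<Rightarrow> label struct) \<Rightarrow> label struct" where
  "assembly_class k F n f B g =
     coll ((\<lambda>\<pi>. Tup [transport F (std k n) \<pi> f,
                     coll ((\<lambda>a. Tup [Lab (\<pi> a), coll (Lab ` B a), g a]) ` std k n)])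
           ` {\<pi>. \<pi> permutes std k n \<and> relabeling \<pi> (std k n) (std k n)})"

definition comp_sp :: "nat \<Rightarrow> species \<Rightarrow> (nat \<Rightarrow> species) \<Rightarrow> species" where
  "comp_sp k F G =
     \<lparr>structs = \<lambda>U. {assembly_class k F n f B g |n f B g. assembly k F G U n f B g},
      transport = \<lambda>U \<sigma> s. THE t. \<exists>n f B g. assembly k F G U n f B g \<and> s = assembly_class k F n f B g \<and>
        t = assembly_class k F n f (\<lambda>a. \<sigma> ` B a) (\<lambda>a. transport (G (fst a)) (B a) \<sigma> (g a))\<rparr>"

text \<open>The composition is defined if \<open>F\<close> has finitely many structures of each total size in the sorts
  for which a species without structure on the empty set is substituted. If these are all
  sorts, this is no restriction.\<close>

definition composable :: "nat \<Rightarrow> species \<Rightarrow> (nat \<Rightarrow> species) \<Rightarrow> bool" where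
  "composable k F G \<longleftrightarrow>
     (\<forall>N. finite {(n, f). (\<forall>i\<ge>k. n i = 0) \<and>
                          (\<Sum>i\<in>{i. i < k \<and> structs (G i) {} = {}}. n i) = N \<and>
                          f \<in> structs F (std k n)})"


section \<open>Well-founded systems\<close>

text \<open>The vector of species substituted for the sorts \<open>(\<Z>, \<Y>\<^sub>1, \<dots>, \<Y>\<^sub>m)\<close>.\<close>

definition args :: "(nat \<Rightarrow> species) \<Rightarrow> nat \<Rightarrow> species" where
  "args Y j = (case j of 0 \<Rightarrow> sort_sp 0 | Suc i \<Rightarrow> Y i)"

primrec iter_sp :: "nat \<Rightarrow> (nat \<Rightarrow> species) \<Rightarrow> nat \<Rightarrow> nat \<Rightarrow> species" where
  "iter_sp m H 0 = (\<lambda>i. zero_sp)"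
| "iter_sp m H (Suc n) = (\<lambda>i. comp_sp (Suc m) (H i) (args (iter_sp m H n)))"

definition iteration_defined :: "nat \<Rightarrow> (nat \<Rightarrow> species) \<Rightarrow> bool" where
  "iteration_defined m H \<longleftrightarrow>
     (\<forall>n. \<forall>i<m. composable (Suc m) (H i) (args (iter_sp m H n)))"

definition system_limit :: "nat \<Rightarrow> (nat \<Rightarrow> species) \<Rightarrow> (nat \<Rightarrow> species) \<Rightarrow> bool" where
  "system_limit m H S \<longleftrightarrow>
     (\<forall>i<m. is_species 1 (S i)) \<and>
     (\<forall>p. \<forall>\<^sub>F n in sequentially. \<forall>i<m.
        species_iso 1 (card_restrict {..p} (iter_sp m H n i)) (card_restrict {..p} (S i)))"

definition well_founded_system :: "nat \<Rightarrow> (nat \<Rightarrow> species) \<Rightarrow> bool" where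
  "well_founded_system m H \<longleftrightarrow>
     iteration_defined m H \<and>
     (\<exists>S. system_limit m H S \<and> (\<forall>i<m. \<exists>U. label_set 1 U \<and> structs (S i) U \<noteq> {}))"

text \<open>The last rule reflects that species are considered up to isomorphism.\<close>

inductive constructible :: "nat \<Rightarrow> species \<Rightarrow> bool" where
  basic: "basic k F \<Longrightarrow> constructible k F"
| basic_card: "basic k F \<Longrightarrow> finite_union_of_intervals I \<Longrightarrow> constructible k (card_restrict I F)"
| comp: "constructible k F \<Longrightarrow> (\<And>i. i < k \<Longrightarrow> constructible l (G i)) \<Longrightarrow> composable k F G \<Longrightarrow>
         constructible l (comp_sp k F G)"
| solution: "(\<And>i. i < m \<Longrightarrow> constructible (Suc m) (H i)) \<Longrightarrow> well_founded_system m H \<Longrightarrow>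
         system_limit m H S \<Longrightarrow> i < m \<Longrightarrow> constructible 1 (S i)"
| iso: "constructible k F \<Longrightarrow> is_species k G \<Longrightarrow> species_iso k F G \<Longrightarrow> constructible k G"


section \<open>Generating series\<close>

definition egf :: "species \<Rightarrow> complex fps" where
  "egf F = Abs_fps (\<lambda>n. of_nat (card (structs F (std 1 (\<lambda>_. n)))) / fact n)"

definition sized_structures :: "species \<Rightarrow> nat \<Rightarrow> (label set \<times> label struct) set" where
  "sized_structures F n = {(U, s). label_set 1 U \<and> card U = n \<and> s \<in> structs F U}"

definition struct_iso :: "species \<Rightarrow> nat \<Rightarrow> ((label set \<times> label struct) \<times> (label set \<times> label struct)) set" where
  "struct_iso F n = {((U, s), (V, t)). (U, s) \<in> sized_structures F n \<and> (V, t) \<in> sized_structures F n \<and>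
                                       (\<exists>\<sigma>. relabeling \<sigma> U V \<and> transport F U \<sigma> s = t)}"

definition ogf :: "species \<Rightarrow> complex fps" where
  "ogf F = Abs_fps (\<lambda>n. of_nat (card (sized_structures F n // struct_iso F n)))"

definition analytic_near_0 :: "complex fps \<Rightarrow> bool" where
  "analytic_near_0 f \<longleftrightarrow>
     (\<exists>r>0. (\<forall>z\<in>ball 0 r. summable (\<lambda>n. fps_nth f n * z ^ n)) \<and>
            (\<lambda>z. \<Sum>n. fps_nth f n * z ^ n) analytic_on ball 0 r)"

end

theory Submission
  imports Defs "HOL-Complex_Analysis.Cauchy_Integral_Formula"
begin

text \<open>
  Both series have coefficients bounded by the number of isomorphism types, up to the factor \<open>n!\<close>
  in the exponential case, so it suffices that a structure of size \<open>n\<close> is determined up to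
  isomorphism by a binary tree of size \<open>O(n)\<close>. This property is inherited by all constructible
  species. A composition \<open>F(G)\<close> is encoded by the code of a representative of the \<open>F\<close>-structure
  together with the codes of its blocks; empty blocks do no harm because the composability
  condition, a finiteness condition, bounds the size of the \<open>F\<close>-structure even linearly in the
  number of nonempty blocks when \<open>F\<close> is constructible.

  A structure defined by a system is a tree whose nodes are structures of the right-hand sides.
  The trees without atoms are finite in number. A node with only one child of positive size leads
  from an unknown \<open>i\<close> to an unknown \<open>j\<close>; if this relation had a cycle, then running around it would
  give infinitely many structures of the same size. Hence chains of such nodes have bounded length,
  and the number of nodes is linear in the number of atoms.
\<close>

section \<open>Relabelings and functoriality\<close>

text \<open>Composability alone bounds the size of an outer structure by some function of the number
  of nonempty blocks, and this function might grow fast; that it is linear has to be carried through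
  the induction. Basic species in several sorts have bounded sizes and species in one sort, among
  them all solutions of systems, are immediate, so only compositions need an argument. Codes are
  relations rather than functions. A structure of a composition has many representing assemblies and
  hence many codes; what matters is that a common code forces an isomorphism and that some code is
  short. This also allows one coding for all levels of an iteration. Convergence provides only
  isomorphisms, a new one for every size. Inclusions between the iterates turn them into equality of
  finite sets, so that a structure has a level of first appearance; a cycle of one-child nodes would
  push this level beyond any bound. The functor laws are separated from the finiteness in
  \<open>is_species\<close> because they pass to compositions without any counting.\<close>

definition functorial :: "nat \<Rightarrow> species \<Rightarrow> bool" where
  "functorial k F \<longleftrightarrow>
     (\<forall>U V \<sigma>. label_set k U \<longrightarrow> relabeling \<sigma> U V \<longrightarrow>
        (\<forall>s\<in>structs F U. transport F U \<sigma> s \<in> structs F V)) \<and>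
     (\<forall>U \<sigma> \<tau>. label_set k U \<longrightarrow> (\<forall>a\<in>U. \<sigma> a = \<tau> a) \<longrightarrow>
        (\<forall>s\<in>structs F U. transport F U \<sigma> s = transport F U \<tau> s)) \<and>
     (\<forall>U. label_set k U \<longrightarrow> (\<forall>s\<in>structs F U. transport F U id s = s)) \<and>
     (\<forall>U V W \<sigma> \<tau>. label_set k U \<longrightarrow> relabeling \<sigma> U V \<longrightarrow> relabeling \<tau> V W \<longrightarrow>
        (\<forall>s\<in>structs F U. transport F U (\<tau> \<circ> \<sigma>) s = transport F V \<tau> (transport F U \<sigma> s)))"

lemma is_species_functorial: "is_species k F \<Longrightarrow> functorial k F"
  unfolding is_species_def functorial_def by blast

lemma functorial_closed:
  "functorial k F \<Longrightarrow> label_set k U \<Longrightarrow> relabeling \<sigma> U V \<Longrightarrow> s \<in> structs F U \<Longrightarrow>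
   transport F U \<sigma> s \<in> structs F V"
  unfolding functorial_def by blast

lemma functorial_cong:
  "functorial k F \<Longrightarrow> label_set k U \<Longrightarrow> s \<in> structs F U \<Longrightarrow> (\<And>a. a \<in> U \<Longrightarrow> \<sigma> a = \<tau> a) \<Longrightarrow>
   transport F U \<sigma> s = transport F U \<tau> s"
  unfolding functorial_def by blast

lemma functorial_id:
  "functorial k F \<Longrightarrow> label_set k U \<Longrightarrow> s \<in> structs F U \<Longrightarrow> transport F U id s = s"
  unfolding functorial_def by blast

lemma functorial_compose:
  "functorial k F \<Longrightarrow> label_set k U \<Longrightarrow> relabeling \<sigma> U V \<Longrightarrow> relabeling \<tau> V W \<Longrightarrow>
   s \<in> structs F U \<Longrightarrow> transport F U (\<tau> \<circ> \<sigma>) s = transport F V \<tau> (transport F U \<sigma> s)"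
  unfolding functorial_def by blast

lemma relabeling_id [simp]: "relabeling id U U"
  by (simp add: relabeling_def)

lemma relabeling_compose: "relabeling \<sigma> U V \<Longrightarrow> relabeling \<tau> V W \<Longrightarrow> relabeling (\<tau> \<circ> \<sigma>) U W"
  unfolding relabeling_def by (auto intro: bij_betw_trans dest: bij_betw_apply)

lemma relabeling_inv_into:
  assumes "relabeling \<sigma> U V"
  shows "relabeling (inv_into U \<sigma>) V U"
proof -
  have bij: "bij_betw \<sigma> U V" and sort: "\<And>a. a \<in> U \<Longrightarrow> fst (\<sigma> a) = fst a"
    using assms by (auto simp: relabeling_def)
  have "fst (inv_into U \<sigma> b) = fst b" if "b \<in> V" for b
    using sort[of "inv_into U \<sigma> b"] bij_betw_inv_into_right[OF bij that]
      bij_betw_apply[OF bij_betw_inv_into[OF bij] that] by simp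
  then show ?thesis
    using bij_betw_inv_into[OF bij] by (simp add: relabeling_def)
qed

lemma relabeling_card: "relabeling \<sigma> U V \<Longrightarrow> card U = card V"
  by (auto simp: relabeling_def intro: bij_betw_same_card)

lemma relabeling_label_set: "relabeling \<sigma> U V \<Longrightarrow> label_set k U \<Longrightarrow> label_set k V"
  unfolding relabeling_def label_set_def
  by (metis bij_betw_finite bij_betw_imp_surj_on imageE)

lemma relabeling_filter:
  assumes "relabeling \<sigma> U V"
  shows "relabeling \<sigma> {a \<in> U. P (fst a)} {a \<in> V. P (fst a)}"
proof -
  have "bij_betw \<sigma> {a \<in> U. P (fst a)} (\<sigma> ` {a \<in> U. P (fst a)})"
    using assms by (auto simp: relabeling_def bij_betw_def intro: inj_on_subset)
  moreover have "\<sigma> ` {a \<in> U. P (fst a)} = {a \<in> V. P (fst a)}"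
    using assms by (auto simp: relabeling_def bij_betw_def)
  ultimately show ?thesis
    using assms by (auto simp: relabeling_def)
qed

lemma relabeling_subset: "relabeling \<sigma> U V \<Longrightarrow> B \<subseteq> U \<Longrightarrow> relabeling \<sigma> B (\<sigma> ` B)"
  by (auto simp: relabeling_def bij_betw_def intro: inj_on_subset)

lemma label_set_subset: "label_set k U \<Longrightarrow> B \<subseteq> U \<Longrightarrow> label_set k B"
  by (auto simp: label_set_def intro: finite_subset)

lemma label_set_finite: "label_set k U \<Longrightarrow> finite U"
  by (simp add: label_set_def)

lemma label_set_std [simp]: "label_set k (std k n)"
  by (auto simp: label_set_def std_def)

lemma finite_std [simp]: "finite (std k n)"
  by (simp add: std_def)

lemma functorial_inverse:
  assumes "functorial k F" "label_set k U" "relabeling \<sigma> U V" "s \<in> structs F U"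
  shows "transport F V (inv_into U \<sigma>) (transport F U \<sigma> s) = s"
proof -
  have "transport F V (inv_into U \<sigma>) (transport F U \<sigma> s) = transport F U (inv_into U \<sigma> \<circ> \<sigma>) s"
    using functorial_compose[OF assms(1-3) relabeling_inv_into[OF assms(3)] assms(4)] by simp
  also have "\<dots> = transport F U id s"
    using assms by (intro functorial_cong[OF assms(1,2,4)])
      (auto simp: relabeling_def bij_betw_inv_into_left)
  finally show ?thesis
    using functorial_id assms by simp
qed

section \<open>Sort sizes as a complete invariant of label sets\<close>

definition sort_card :: "nat \<Rightarrow> label set \<Rightarrow> nat" where
  "sort_card i U = card {a \<in> U. fst a = i}"

lemma sort_card_std: "i < k \<Longrightarrow> sort_card i (std k n) = n i"
proof -
  assume "i < k"
  then have "{a \<in> std k n. fst a = i} = Pair i ` {1..n i}"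
    by (auto simp: std_def)
  then show ?thesis
    by (simp add: sort_card_def card_image inj_on_def)
qed

lemma relabeling_sort_card: "relabeling \<sigma> U V \<Longrightarrow> sort_card i U = sort_card i V"
  unfolding sort_card_def by (rule relabeling_card[OF relabeling_filter[where P = "\<lambda>j. j = i"]])

text \<open>Sort sizes are invariant under relabeling and determine a standard set. The functions
  \<open>n\<close> and \<open>n'\<close> themselves may differ from index \<open>k\<close>
  on.\<close>

lemma relabeling_std:
  assumes "relabeling \<sigma> (std k n) (std k n')"
  shows "std k n = std k n'"
proof -
  have "n i = n' i" if "i < k" for i
    using relabeling_sort_card[OF assms, of i] that by (simp add: sort_card_std)
  then show ?thesis
    by (auto simp: std_def)
qed

lemma relabeling_exists:
  assumes "label_set k U" "label_set k V" "\<And>i. i < k \<Longrightarrow> sort_card i U = sort_card i V"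
  shows "\<exists>\<sigma>. relabeling \<sigma> U V"
proof -
  have "\<exists>h. bij_betw h {a \<in> U. fst a = i} {a \<in> V. fst a = i}" if "i < k" for i
    using assms that by (intro finite_same_card_bij) (auto simp: label_set_def sort_card_def)
  then have "\<forall>i. \<exists>h. i < k \<longrightarrow> bij_betw h {a \<in> U. fst a = i} {a \<in> V. fst a = i}"
    by blast
  from choice[OF this] obtain h where
    h: "\<And>i. i < k \<Longrightarrow> bij_betw (h i) {a \<in> U. fst a = i} {a \<in> V. fst a = i}"
    by blast
  define \<sigma> where "\<sigma> a = h (fst a) a" for a
  have fst_\<sigma>: "fst (\<sigma> a) = fst a \<and> \<sigma> a \<in> V" if "a \<in> U" for a
    using bij_betw_apply[OF h[of "fst a"], of a] that assms(1) by (auto simp: label_set_def \<sigma>_def)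
  have "inj_on \<sigma> U"
  proof (rule inj_onI)
    fix a b assume *: "a \<in> U" "b \<in> U" "\<sigma> a = \<sigma> b"
    then have ab: "fst a = fst b" using fst_\<sigma>[of a] fst_\<sigma>[of b] by simp
    have "inj_on (h (fst a)) {b \<in> U. fst b = fst a}"
      using h[of "fst a"] * assms(1) by (simp add: label_set_def bij_betw_def)
    moreover have "h (fst a) a = h (fst a) b"
      using * ab by (simp add: \<sigma>_def)
    ultimately show "a = b"
      using * ab by (auto dest: inj_onD)
  qed
  moreover have "V \<subseteq> \<sigma> ` U"
  proof
    fix b assume b: "b \<in> V"
    then have "b \<in> h (fst b) ` {a \<in> U. fst a = fst b}"
      using h[of "fst b"] assms(2) by (auto simp: label_set_def bij_betw_def)
    then obtain a where "a \<in> U" "fst a = fst b" "b = h (fst b) a"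
      by blast
    then show "b \<in> \<sigma> ` U"
      by (intro image_eqI[of _ _ a]) (simp_all add: \<sigma>_def)
  qed
  ultimately have "relabeling \<sigma> U V"
    using fst_\<sigma> by (auto simp: relabeling_def bij_betw_def)
  then show ?thesis by blast
qed

lemma relabeling_to_std:
  assumes "label_set k U"
  shows "\<exists>\<sigma>. relabeling \<sigma> U (std k (\<lambda>i. if i < k then sort_card i U else 0))"
  by (rule relabeling_exists[OF assms]) (auto simp: sort_card_std)

section \<open>Finite collections as structures\<close>

lemma coll_inject: "finite X \<Longrightarrow> finite Y \<Longrightarrow> coll X = coll Y \<longleftrightarrow> X = Y"
  by (simp add: coll_def Abs_fset_inject)

lemma coll_Lab_inject: "finite X \<Longrightarrow> finite Y \<Longrightarrow> coll (Lab ` X) = coll (Lab ` Y) \<longleftrightarrow> X = Y"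
  by (subst coll_inject) (auto simp: inj_image_eq_iff inj_def)

lemma map_struct_coll:
  assumes "finite X"
  shows "map_struct \<sigma> (coll X) = coll (map_struct \<sigma> ` X)"
proof -
  have "map_struct \<sigma> |`| Abs_fset X = Abs_fset (map_struct \<sigma> ` X)"
    using assms by (simp add: fset_inject[symmetric] Abs_fset_inverse)
  then show ?thesis
    by (simp add: coll_def)
qed

lemma set_struct_coll: "finite X \<Longrightarrow> set_struct (coll X) = (\<Union>x\<in>X. set_struct x)"
  by (simp add: coll_def Abs_fset_inverse)

section \<open>Basic species\<close>

text \<open>All basic species transport by \<open>map_struct\<close>, for which identity and
  composition are automatic. That the labels of a structure lie in \<open>U\<close> gives the
  independence of the values of \<sigma> outside \<open>U\<close>.\<close>

lemma functorial_map_struct: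
  assumes tr: "transport F = (\<lambda>U. map_struct)"
    and sub: "\<And>U s. label_set k U \<Longrightarrow> s \<in> structs F U \<Longrightarrow> set_struct s \<subseteq> U"
    and cl: "\<And>U V \<sigma> s. label_set k U \<Longrightarrow> relabeling \<sigma> U V \<Longrightarrow> s \<in> structs F U \<Longrightarrow>
               map_struct \<sigma> s \<in> structs F V"
  shows "functorial k F"
  unfolding functorial_def tr
proof (intro conjI allI impI ballI)
  fix U \<sigma> \<tau> s assume "label_set k U" "\<forall>a\<in>U. \<sigma> a = \<tau> a" "s \<in> structs F U"
  then show "map_struct \<sigma> s = map_struct \<tau> s"
    using sub by (intro struct.map_cong0) blast
qed (auto simp: cl struct.map_id struct.map_comp)

text \<open>Basic species meet this condition, cardinality constraints preserve it, and it lets the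
  tuple of sort sizes serve as a code.\<close>

definition one_type_per_profile :: "nat \<Rightarrow> species \<Rightarrow> bool" where
  "one_type_per_profile k F \<longleftrightarrow>
     (\<forall>U V s t. label_set k U \<longrightarrow> label_set k V \<longrightarrow> s \<in> structs F U \<longrightarrow> t \<in> structs F V \<longrightarrow>
        (\<forall>i<k. sort_card i U = sort_card i V) \<longrightarrow>
        (\<exists>\<sigma>. relabeling \<sigma> U V \<and> transport F U \<sigma> s = t))"

definition bounded_size :: "species \<Rightarrow> bool" where
  "bounded_size F \<longleftrightarrow> (\<exists>c. \<forall>U. structs F U \<noteq> {} \<longrightarrow> card U \<le> c)"

lemma relabeling_singleton: "relabeling \<sigma> {(i, x)} V \<Longrightarrow> \<exists>y. \<sigma> (i, x) = (i, y) \<and> V = {(i, y)}"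
  by (cases "\<sigma> (i, x)") (auto simp: relabeling_def bij_betw_def)

lemma basic_one: "functorial k one_sp \<and> one_type_per_profile k one_sp \<and> bounded_size one_sp"
proof (intro conjI)
  show "functorial k one_sp"
    by (rule functorial_map_struct)
      (auto simp: one_sp_def relabeling_def bij_betw_def split: if_splits)
  show "one_type_per_profile k one_sp"
    unfolding one_type_per_profile_def
    by (auto simp: one_sp_def intro!: exI[of _ id] split: if_splits)
  show "bounded_size one_sp"
    by (auto simp: bounded_size_def one_sp_def intro!: exI[of _ 0])
qed

lemma basic_sort: "functorial k (sort_sp i) \<and> one_type_per_profile k (sort_sp i) \<and> bounded_size (sort_sp i)"
proof (intro conjI)
  show "functorial k (sort_sp i)"
    by (rule functorial_map_struct) (auto simp: sort_sp_def dest!: relabeling_singleton)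
  show "one_type_per_profile k (sort_sp i)"
    unfolding one_type_per_profile_def
  proof (intro allI impI)
    fix U V s t assume "s \<in> structs (sort_sp i) U" "t \<in> structs (sort_sp i) V"
    then obtain x y where "U = {(i, x)}" "V = {(i, y)}" "s = Lab (i, x)" "t = Lab (i, y)"
      by (auto simp: sort_sp_def)
    then show "\<exists>\<sigma>. relabeling \<sigma> U V \<and> transport (sort_sp i) U \<sigma> s = t"
      by (intro exI[of _ "\<lambda>_. (i, y)"]) (auto simp: sort_sp_def relabeling_def bij_betw_def)
  qed
  show "bounded_size (sort_sp i)"
    by (auto simp: bounded_size_def sort_sp_def intro!: exI[of _ 1])
qed

lemma basic_plus: "functorial 2 plus_sp \<and> one_type_per_profile 2 plus_sp \<and> bounded_size plus_sp"
proof (intro conjI)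
  show "functorial 2 plus_sp"
    by (rule functorial_map_struct) (auto simp: plus_sp_def dest!: relabeling_singleton)
  show "one_type_per_profile 2 plus_sp"
    unfolding one_type_per_profile_def
  proof (intro allI impI)
    fix U V s t assume "s \<in> structs plus_sp U" "t \<in> structs plus_sp V"
      and eq: "\<forall>i<2. sort_card i U = sort_card i V"
    then obtain i j x y where *: "U = {(i, x)}" "V = {(j, y)}" "s = Lab (i, x)" "t = Lab (j, y)"
      "i < 2" "j < 2"
      by (auto simp: plus_sp_def)
    \<comment> \<open>The sort of the only label can be read off from the sort sizes.\<close>
    have "sort_card i {(i', z)} = (if i' = i then 1 else 0)" for i' z
      by (auto simp: sort_card_def Collect_conv_if)
    with eq * have "i = j"
      by (metis (full_types) zero_neq_one)
    with * show "\<exists>\<sigma>. relabeling \<sigma> U V \<and> transport plus_sp U \<sigma> s = t"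
      by (intro exI[of _ "\<lambda>_. (i, y)"]) (auto simp: plus_sp_def relabeling_def bij_betw_def)
  qed
  show "bounded_size plus_sp"
    by (auto simp: bounded_size_def plus_sp_def intro!: exI[of _ 1])
qed

lemma basic_times: "functorial 2 times_sp \<and> one_type_per_profile 2 times_sp \<and> bounded_size times_sp"
proof (intro conjI)
  show "functorial 2 times_sp"
  proof (rule functorial_map_struct)
    fix U V \<sigma> s assume \<sigma>: "relabeling \<sigma> U V" and "s \<in> structs times_sp U"
    then obtain x y where *: "U = {(0, x), (1, y)}" "s = Tup [Lab (0, x), Lab (1, y)]"
      by (auto simp: times_sp_def)
    obtain x' y' where "\<sigma> (0, x) = (0, x')" "\<sigma> (1, y) = (1, y')"
      using \<sigma> * by (cases "\<sigma> (0, x)"; cases "\<sigma> (1, y)") (auto simp: relabeling_def)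
    then show "map_struct \<sigma> s \<in> structs times_sp V"
      using \<sigma> * by (auto simp: times_sp_def relabeling_def bij_betw_def)
  qed (auto simp: times_sp_def)
  show "one_type_per_profile 2 times_sp"
    unfolding one_type_per_profile_def
  proof (intro allI impI)
    fix U V s t assume "s \<in> structs times_sp U" "t \<in> structs times_sp V"
    then obtain x y x' y' where "U = {(0, x), (1, y)}" "s = Tup [Lab (0, x), Lab (1, y)]"
      "V = {(0, x'), (1, y')}" "t = Tup [Lab (0, x'), Lab (1, y')]"
      by (auto simp: times_sp_def)
    then show "\<exists>\<sigma>. relabeling \<sigma> U V \<and> transport times_sp U \<sigma> s = t"
      by (intro exI[of _ "\<lambda>a. if fst a = 0 then (0, x') else (1, y')"])
        (auto simp: times_sp_def relabeling_def bij_betw_def)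
  qed
  show "bounded_size times_sp"
    by (auto simp: bounded_size_def times_sp_def intro!: exI[of _ 2])
qed

lemma distinct_map_relabeling:
  assumes "label_set 1 (set xs)" "label_set 1 (set ys)" "distinct xs" "distinct ys"
    "length xs = length ys"
  shows "\<exists>\<sigma>. relabeling \<sigma> (set xs) (set ys) \<and> map \<sigma> xs = ys"
proof -
  define \<sigma> where "\<sigma> = the \<circ> map_of (zip xs ys)"
  have m: "map \<sigma> xs = ys"
  proof (rule nth_equalityI)
    fix i assume "i < length (map \<sigma> xs)"
    then show "map \<sigma> xs ! i = ys ! i"
      using assms map_of_zip_nth[of xs ys i] by (simp add: \<sigma>_def)
  qed (simp add: assms)
  then have "\<sigma> ` set xs = set ys"
    by (metis set_map)
  moreover have "inj_on \<sigma> (set xs)"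
    using m assms by (metis distinct_map)
  ultimately have "relabeling \<sigma> (set xs) (set ys)"
    using assms(1,2) unfolding relabeling_def bij_betw_def label_set_def by force
  with m show ?thesis by blast
qed

lemma sort_card_1: "label_set 1 U \<Longrightarrow> sort_card 0 U = card U"
  unfolding sort_card_def label_set_def by (rule arg_cong[where f = card]) auto

lemma basic_seq: "functorial 1 seq_sp \<and> one_type_per_profile 1 seq_sp"
proof (intro conjI)
  show "functorial 1 seq_sp"
  proof (rule functorial_map_struct)
    fix U V \<sigma> s assume \<sigma>: "relabeling \<sigma> U V" and "s \<in> structs seq_sp U"
    then obtain xs where "s = Tup (map Lab xs)" "distinct xs" "set xs = U"
      by (auto simp: seq_sp_def)
    then show "map_struct \<sigma> s \<in> structs seq_sp V"
      using \<sigma> by (auto simp: seq_sp_def relabeling_def bij_betw_def distinct_map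
          intro!: exI[of _ "map \<sigma> xs"])
  qed (auto simp: seq_sp_def)
  show "one_type_per_profile 1 seq_sp"
    unfolding one_type_per_profile_def
  proof (intro allI impI)
    fix U V s t
    assume l: "label_set 1 U" "label_set 1 V" and "s \<in> structs seq_sp U" "t \<in> structs seq_sp V"
      and eq: "\<forall>i<1. sort_card i U = sort_card i V"
    then obtain xs ys where *: "s = Tup (map Lab xs)" "distinct xs" "set xs = U"
      "t = Tup (map Lab ys)" "distinct ys" "set ys = V"
      by (auto simp: seq_sp_def)
    have "length xs = length ys"
      using * eq l by (auto simp: sort_card_1 distinct_card)
    then obtain \<sigma> where "relabeling \<sigma> U V" "map \<sigma> xs = ys"
      using distinct_map_relabeling[of xs ys] l * by auto
    then show "\<exists>\<sigma>. relabeling \<sigma> U V \<and> transport seq_sp U \<sigma> s = t"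
      using * by (auto simp: seq_sp_def intro!: exI[of _ \<sigma>])
  qed
qed

lemma basic_set: "functorial 1 set_sp \<and> one_type_per_profile 1 set_sp"
proof -
  have *: "map_struct \<sigma> (coll (Lab ` U)) = coll (Lab ` V)" if "label_set 1 U" "relabeling \<sigma> U V" for \<sigma> U V
    using that
    by (auto simp: map_struct_coll label_set_finite relabeling_def bij_betw_def image_image)
  have "functorial 1 set_sp"
    by (rule functorial_map_struct) (auto simp: set_sp_def * set_struct_coll label_set_finite)
  moreover have "one_type_per_profile 1 set_sp"
    unfolding one_type_per_profile_def
  proof (intro allI impI)
    fix U V s t
    assume l: "label_set 1 U" "label_set 1 V" and st: "s \<in> structs set_sp U" "t \<in> structs set_sp V"
      and "\<forall>i<1. sort_card i U = sort_card i V"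
    then obtain \<sigma> where "relabeling \<sigma> U V"
      using relabeling_exists[of 1 U V] by blast
    then show "\<exists>\<sigma>. relabeling \<sigma> U V \<and> transport set_sp U \<sigma> s = t"
      using st *[OF l(1)] by (intro exI[of _ \<sigma>]) (simp add: set_sp_def)
  qed
  ultimately show ?thesis ..
qed

text \<open>In \<open>cyc_sp\<close> the shift \<open>j\<close> runs over all natural numbers, but
  the rotations are lists of one length over a finite set. Results on \<open>coll\<close> require
  this finiteness.\<close>

lemma finite_rotations: "finite {Tup (map Lab (rotate j xs)) |j. True}"
proof -
  have "{Tup (map Lab (rotate j xs)) |j. True} \<subseteq>
      (\<lambda>zs. Tup (map Lab zs)) ` {zs. set zs \<subseteq> set xs \<and> length zs = length xs}"
    by auto
  then show ?thesis
    by (rule finite_subset) (simp add: finite_lists_length_eq)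
qed

lemma map_struct_rotations:
  "map_struct \<sigma> (coll {Tup (map Lab (rotate j xs)) |j. True}) =
   coll {Tup (map Lab (rotate j (map \<sigma> xs))) |j. True}"
proof -
  have "map_struct \<sigma> ` {Tup (map Lab (rotate j xs)) |j. True} =
      (\<lambda>j. map_struct \<sigma> (Tup (map Lab (rotate j xs)))) ` UNIV"
    by blast
  also have "\<dots> = (\<lambda>j. Tup (map Lab (rotate j (map \<sigma> xs)))) ` UNIV"
    by (simp add: rotate_map comp_def)
  finally show ?thesis
    unfolding map_struct_coll[OF finite_rotations] by (simp add: full_SetCompr_eq)
qed

lemma basic_cyc: "functorial 1 cyc_sp \<and> one_type_per_profile 1 cyc_sp"
proof (intro conjI)
  show "functorial 1 cyc_sp"
  proof (rule functorial_map_struct)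
    fix U V \<sigma> s assume \<sigma>: "relabeling \<sigma> U V" and "s \<in> structs cyc_sp U"
    then obtain xs where xs: "s = coll {Tup (map Lab (rotate j xs)) |j. True}"
      "xs \<noteq> []" "distinct xs" "set xs = U"
      by (auto simp: cyc_sp_def)
    then have "map_struct \<sigma> s = coll {Tup (map Lab (rotate j (map \<sigma> xs))) |j. True}"
      by (simp only: map_struct_rotations)
    moreover have "map \<sigma> xs \<noteq> []" "distinct (map \<sigma> xs)" "set (map \<sigma> xs) = V"
      using \<sigma> xs by (auto simp: relabeling_def bij_betw_def distinct_map)
    ultimately show "map_struct \<sigma> s \<in> structs cyc_sp V"
      unfolding cyc_sp_def by auto
  next
    fix U s assume "s \<in> structs cyc_sp U"
    then obtain xs where "s = coll {Tup (map Lab (rotate j xs)) |j. True}" "set xs = U"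
      by (auto simp: cyc_sp_def)
    then show "set_struct s \<subseteq> U"
      by (simp only: set_struct_coll[OF finite_rotations]) auto
  qed (simp add: cyc_sp_def)
  show "one_type_per_profile 1 cyc_sp"
    unfolding one_type_per_profile_def
  proof (intro allI impI)
    fix U V s t
    assume l: "label_set 1 U" "label_set 1 V" and "s \<in> structs cyc_sp U" "t \<in> structs cyc_sp V"
      and eq: "\<forall>i<1. sort_card i U = sort_card i V"
    then obtain xs ys where *: "s = coll {Tup (map Lab (rotate j xs)) |j. True}" "distinct xs" "set xs = U"
      "t = coll {Tup (map Lab (rotate j ys)) |j. True}" "distinct ys" "set ys = V"
      by (auto simp: cyc_sp_def)
    have "length xs = length ys"
      using * eq l by (auto simp: sort_card_1 distinct_card)
    then obtain \<sigma> where "relabeling \<sigma> U V" "map \<sigma> xs = ys"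
      using distinct_map_relabeling[of xs ys] l * by auto
    then show "\<exists>\<sigma>. relabeling \<sigma> U V \<and> transport cyc_sp U \<sigma> s = t"
      using * map_struct_rotations[of \<sigma> xs] by (auto simp: cyc_sp_def intro!: exI[of _ \<sigma>])
  qed
qed

text \<open>The final alternative is what makes sizes linear later: one sort and bounded size are
  the two easy cases of \<open>linear_sizes\<close>.\<close>

lemma basic_properties:
  "basic k F \<Longrightarrow> functorial k F \<and> one_type_per_profile k F \<and> (k = 1 \<or> bounded_size F)"
  using basic_one basic_sort basic_plus basic_times basic_seq basic_set basic_cyc
  by (auto elim!: basic.cases)

lemma functorial_card_restrict: "functorial k F \<Longrightarrow> functorial k (card_restrict I F)"
  unfolding functorial_def card_restrict_def by (auto dest: relabeling_card)

lemma one_type_per_profile_card_restrict: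
  "one_type_per_profile k F \<Longrightarrow> one_type_per_profile k (card_restrict I F)"
  unfolding one_type_per_profile_def card_restrict_def by (auto split: if_splits)

lemma bounded_size_card_restrict: "bounded_size F \<Longrightarrow> bounded_size (card_restrict I F)"
  unfolding bounded_size_def card_restrict_def by auto

section \<open>Composition\<close>

text \<open>The group acting on the indices; \<open>assembly_class\<close> collects an orbit under
  it.\<close>

definition sort_perms :: "nat \<Rightarrow> (nat \<Rightarrow> nat) \<Rightarrow> (label \<Rightarrow> label) set" where
  "sort_perms k n = {\<pi>. \<pi> permutes std k n \<and> relabeling \<pi> (std k n) (std k n)}"

lemma finite_sort_perms [simp]: "finite (sort_perms k n)"
  unfolding sort_perms_def by (rule finite_subset[OF _ finite_permutations[OF finite_std]]) auto

lemma id_in_sort_perms: "id \<in> sort_perms k n"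
  by (simp add: sort_perms_def permutes_id)

lemma sort_perms_fst: "\<pi> \<in> sort_perms k n \<Longrightarrow> a \<in> std k n \<Longrightarrow> fst (\<pi> a) = fst a"
  by (auto simp: sort_perms_def relabeling_def)

lemma sort_perms_image: "\<pi> \<in> sort_perms k n \<Longrightarrow> \<pi> ` std k n = std k n"
  by (simp add: sort_perms_def permutes_image)

lemma sort_perms_in: "\<pi> \<in> sort_perms k n \<Longrightarrow> a \<in> std k n \<Longrightarrow> \<pi> a \<in> std k n"
  by (auto simp: sort_perms_def permutes_in_image)

lemma sort_perms_relabeling: "\<pi> \<in> sort_perms k n \<Longrightarrow> relabeling \<pi> (std k n) (std k n)"
  by (simp add: sort_perms_def)

lemma sort_perms_compose: "\<pi> \<in> sort_perms k n \<Longrightarrow> \<rho> \<in> sort_perms k n \<Longrightarrow> \<rho> \<circ> \<pi> \<in> sort_perms k n"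
  by (auto simp: sort_perms_def intro: permutes_compose relabeling_compose)

text \<open>A relabeling is arbitrary outside its domain, whereas \<open>permutes\<close> demands
  the identity there.\<close>

lemma relabeling_agrees_sort_perm:
  assumes "relabeling \<sigma> (std k n) (std k n)"
  obtains \<pi> where "\<pi> \<in> sort_perms k n" "\<And>a. a \<in> std k n \<Longrightarrow> \<pi> a = \<sigma> a"
proof
  define \<pi> where "\<pi> a = (if a \<in> std k n then \<sigma> a else a)" for a
  show agree: "\<pi> a = \<sigma> a" if "a \<in> std k n" for a
    using that by (simp add: \<pi>_def)
  have "bij_betw \<pi> (std k n) (std k n)"
    using assms bij_betw_cong[of "std k n" \<pi> \<sigma>] agree by (auto simp: relabeling_def)
  then have "\<pi> permutes std k n"
    by (intro bij_imp_permutes) (auto simp: \<pi>_def)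
  with \<open>bij_betw \<pi> _ _\<close> show "\<pi> \<in> sort_perms k n"
    using assms agree by (simp add: sort_perms_def relabeling_def)
qed

lemma sort_perm_inverse:
  assumes "\<pi> \<in> sort_perms k n"
  obtains \<rho> where "\<rho> \<in> sort_perms k n" "\<rho> \<circ> \<pi> = id" "\<pi> \<circ> \<rho> = id"
proof
  have p: "\<pi> permutes std k n" using assms by (simp add: sort_perms_def)
  show "inv \<pi> \<circ> \<pi> = id" "\<pi> \<circ> inv \<pi> = id"
    using permutes_inv_o[OF p] by auto
  have "fst (inv \<pi> a) = fst a" if "a \<in> std k n" for a
  proof -
    have "fst (\<pi> (inv \<pi> a)) = fst (inv \<pi> a)"
      using sort_perms_fst[OF assms] permutes_in_image[OF permutes_inv[OF p]] that by blast
    then show ?thesis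
      using permutes_inverses[OF p] by simp
  qed
  then show "inv \<pi> \<in> sort_perms k n"
    using permutes_inv[OF p] by (auto simp: sort_perms_def relabeling_def permutes_imp_bij)
qed

section \<open>Assemblies up to renaming of the indices\<close>

lemma assembly_class_cong:
  assumes "std k n = std k n'" "\<And>a. a \<in> std k n \<Longrightarrow> B a = B' a" "\<And>a. a \<in> std k n \<Longrightarrow> g a = g' a"
  shows "assembly_class k F n f B g = assembly_class k F n' f B' g'"
proof -
  have "(\<lambda>a. Tup [Lab (\<pi> a), coll (Lab ` B a), g a]) ` std k n =
      (\<lambda>a. Tup [Lab (\<pi> a), coll (Lab ` B' a), g' a]) ` std k n" for \<pi> :: "label \<Rightarrow> label"
    using assms(2,3) by (intro image_cong) auto
  then show ?thesis
    unfolding assembly_class_def assms(1)[symmetric] by simp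
qed

text \<open>The member of the first class belonging to the identity must occur in the second class,
  say for \<pi>. Its triples carry the index as a label, so they form the graphs of \<open>B\<close>
  and \<open>g\<close>, which can be compared index by index.\<close>

lemma assembly_class_eqD:
  assumes F: "functorial k F" "f \<in> structs F (std k n)"
    and fin: "\<And>a. a \<in> std k n \<Longrightarrow> finite (B a)" "\<And>a. a \<in> std k n' \<Longrightarrow> finite (B' a)"
    and eq: "assembly_class k F n f B g = assembly_class k F n' f' B' g'"
  obtains \<pi> where "std k n = std k n'" "\<pi> \<in> sort_perms k n'"
    "f = transport F (std k n') \<pi> f'"
    "\<And>a. a \<in> std k n' \<Longrightarrow> B (\<pi> a) = B' a" "\<And>a. a \<in> std k n' \<Longrightarrow> g (\<pi> a) = g' a"
proof -
  define X where "X \<pi> = Tup [transport F (std k n) \<pi> f,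
      coll ((\<lambda>a. Tup [Lab (\<pi> a), coll (Lab ` B a), g a]) ` std k n)]" for \<pi>
  define X' where "X' \<pi> = Tup [transport F (std k n') \<pi> f',
      coll ((\<lambda>a. Tup [Lab (\<pi> a), coll (Lab ` B' a), g' a]) ` std k n')]" for \<pi>
  have "coll (X ` sort_perms k n) = coll (X' ` sort_perms k n')"
    using eq unfolding assembly_class_def X_def X'_def sort_perms_def .
  then have "X ` sort_perms k n = X' ` sort_perms k n'"
    by (subst (asm) coll_inject) auto
  then have "X id \<in> X' ` sort_perms k n'"
    using id_in_sort_perms by blast
  then obtain \<pi> where \<pi>: "\<pi> \<in> sort_perms k n'" and Xeq: "X id = X' \<pi>"
    by blast
  have f: "f = transport F (std k n') \<pi> f'"
    using Xeq functorial_id[OF F(1) label_set_std F(2)] by (simp add: X_def X'_def)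
  have "coll ((\<lambda>a. Tup [Lab a, coll (Lab ` B a), g a]) ` std k n) =
      coll ((\<lambda>a. Tup [Lab (\<pi> a), coll (Lab ` B' a), g' a]) ` std k n')"
    using Xeq by (simp add: X_def X'_def)
  then have img: "(\<lambda>a. Tup [Lab a, coll (Lab ` B a), g a]) ` std k n =
      (\<lambda>a. Tup [Lab (\<pi> a), coll (Lab ` B' a), g' a]) ` std k n'"
    by (subst (asm) coll_inject) auto
  have *: "\<pi> a \<in> std k n \<and> B (\<pi> a) = B' a \<and> g (\<pi> a) = g' a" if a: "a \<in> std k n'" for a
  proof -
    have "Tup [Lab (\<pi> a), coll (Lab ` B' a), g' a] \<in>
        (\<lambda>a. Tup [Lab a, coll (Lab ` B a), g a]) ` std k n"
      unfolding img using a by blast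
    then obtain b where b: "b \<in> std k n" "\<pi> a = b" "coll (Lab ` B' a) = coll (Lab ` B b)" "g' a = g b"
      by auto
    moreover have "B' a = B b"
      using b fin a by (simp add: coll_Lab_inject)
    ultimately show ?thesis by auto
  qed
  have "\<pi> ` std k n' \<subseteq> std k n"
    by (rule image_subsetI) (simp add: *)
  then have "std k n' \<subseteq> std k n"
    by (simp only: sort_perms_image[OF \<pi>])
  moreover have "std k n \<subseteq> std k n'"
  proof
    fix b assume "b \<in> std k n"
    then have "Tup [Lab b, coll (Lab ` B b), g b] \<in>
        (\<lambda>a. Tup [Lab (\<pi> a), coll (Lab ` B' a), g' a]) ` std k n'"
      unfolding img[symmetric] by blast
    then show "b \<in> std k n'"
      using sort_perms_in[OF \<pi>] by auto
  qed
  ultimately have "std k n = std k n'"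
    by simp
  then show ?thesis
    using that[OF _ \<pi> f] * by simp
qed

text \<open>Right multiplication by \<pi> is a bijection of the group and matches the members of the
  two classes.\<close>

lemma assembly_class_permute:
  assumes F: "functorial k F" "f \<in> structs F (std k n)" and \<pi>: "\<pi> \<in> sort_perms k n"
  shows "assembly_class k F n (transport F (std k n) \<pi> f) B g =
         assembly_class k F n f (B \<circ> \<pi>) (g \<circ> \<pi>)"
proof -
  define X where "X \<rho> = Tup [transport F (std k n) \<rho> (transport F (std k n) \<pi> f),
      coll ((\<lambda>a. Tup [Lab (\<rho> a), coll (Lab ` B a), g a]) ` std k n)]" for \<rho>
  define Y where "Y \<rho> = Tup [transport F (std k n) \<rho> f,
      coll ((\<lambda>a. Tup [Lab (\<rho> a), coll (Lab ` B (\<pi> a)), g (\<pi> a)]) ` std k n)]" for \<rho>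
  obtain \<theta> where \<theta>: "\<theta> \<in> sort_perms k n" "\<theta> \<circ> \<pi> = id" "\<pi> \<circ> \<theta> = id"
    using sort_perm_inverse[OF \<pi>] .
  have XY: "X \<rho> = Y (\<rho> \<circ> \<pi>)" if "\<rho> \<in> sort_perms k n" for \<rho>
  proof -
    have "(\<lambda>a. Tup [Lab ((\<rho> \<circ> \<pi>) a), coll (Lab ` B (\<pi> a)), g (\<pi> a)]) ` std k n =
        (\<lambda>a. Tup [Lab (\<rho> a), coll (Lab ` B a), g a]) ` \<pi> ` std k n"
      by (simp add: image_image)
    moreover have "transport F (std k n) (\<rho> \<circ> \<pi>) f =
        transport F (std k n) \<rho> (transport F (std k n) \<pi> f)"
      using functorial_compose[OF F(1) label_set_std] sort_perms_relabeling \<pi> that F(2) by blast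
    ultimately show ?thesis
      unfolding X_def Y_def sort_perms_image[OF \<pi>] by simp
  qed
  have "X ` sort_perms k n = Y ` (\<lambda>\<rho>. \<rho> \<circ> \<pi>) ` sort_perms k n"
    unfolding image_image by (rule image_cong) (auto simp: XY)
  also have "(\<lambda>\<rho>. \<rho> \<circ> \<pi>) ` sort_perms k n = sort_perms k n"
  proof
    show "(\<lambda>\<rho>. \<rho> \<circ> \<pi>) ` sort_perms k n \<subseteq> sort_perms k n"
      using sort_perms_compose \<pi> by blast
    show "sort_perms k n \<subseteq> (\<lambda>\<rho>. \<rho> \<circ> \<pi>) ` sort_perms k n"
    proof
      fix \<rho> assume "\<rho> \<in> sort_perms k n"
      then have "\<rho> \<circ> \<theta> \<in> sort_perms k n"
        using sort_perms_compose \<theta> by blast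
      moreover have "\<rho> = (\<rho> \<circ> \<theta>) \<circ> \<pi>"
        using \<theta> by (simp add: comp_assoc)
      ultimately show "\<rho> \<in> (\<lambda>\<rho>. \<rho> \<circ> \<pi>) ` sort_perms k n" by blast
    qed
  qed
  finally show ?thesis
    unfolding assembly_class_def X_def Y_def sort_perms_def comp_def by simp
qed

lemma assembly_block_subset: "assembly k F G U n f B g \<Longrightarrow> a \<in> std k n \<Longrightarrow> B a \<subseteq> U"
  unfolding assembly_def by blast

lemma assembly_block_finite:
  "assembly k F G U n f B g \<Longrightarrow> finite U \<Longrightarrow> a \<in> std k n \<Longrightarrow> finite (B a)"
  by (rule finite_subset[OF assembly_block_subset])

lemma fst_std: "a \<in> std k n \<Longrightarrow> fst a < k"
  by (auto simp: std_def)

lemma structs_comp: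
  "s \<in> structs (comp_sp k F G) U \<longleftrightarrow>
   (\<exists>n f B g. assembly k F G U n f B g \<and> s = assembly_class k F n f B g)"
  by (auto simp: comp_sp_def)

text \<open>This justifies the \<open>THE\<close> in \<open>comp_sp\<close>: two assemblies with one
  class differ by a renaming of indices, and such a renaming commutes with \<sigma>, which acts on
  the labels inside the blocks.\<close>

lemma transport_comp:
  assumes F: "functorial k F" and fin: "finite U" and as: "assembly k F G U n f B g"
  shows "transport (comp_sp k F G) U \<sigma> (assembly_class k F n f B g) =
         assembly_class k F n f (\<lambda>a. \<sigma> ` B a) (\<lambda>a. transport (G (fst a)) (B a) \<sigma> (g a))"
proof -
  have "t = assembly_class k F n f (\<lambda>a. \<sigma> ` B a) (\<lambda>a. transport (G (fst a)) (B a) \<sigma> (g a))"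
    if as': "assembly k F G U n' f' B' g'"
      and eq: "assembly_class k F n f B g = assembly_class k F n' f' B' g'"
      and t: "t = assembly_class k F n' f' (\<lambda>a. \<sigma> ` B' a) (\<lambda>a. transport (G (fst a)) (B' a) \<sigma> (g' a))"
    for t n' f' B' g'
  proof -
    have f: "f \<in> structs F (std k n)" and f': "f' \<in> structs F (std k n')"
      using as as' by (auto simp: assembly_def)
    obtain \<pi> where \<pi>: "std k n = std k n'" "\<pi> \<in> sort_perms k n'" "f = transport F (std k n') \<pi> f'"
      "\<And>a. a \<in> std k n' \<Longrightarrow> B (\<pi> a) = B' a" "\<And>a. a \<in> std k n' \<Longrightarrow> g (\<pi> a) = g' a"
      using assembly_class_eqD[OF F f assembly_block_finite[OF as fin]
        assembly_block_finite[OF as' fin] eq] by metis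
    let ?B = "\<lambda>a. \<sigma> ` B a" and ?g = "\<lambda>a. transport (G (fst a)) (B a) \<sigma> (g a)"
    have "assembly_class k F n f ?B ?g = assembly_class k F n' f ?B ?g"
      using \<pi>(1) by (intro assembly_class_cong) auto
    also have "\<dots> = assembly_class k F n' f' (?B \<circ> \<pi>) (?g \<circ> \<pi>)"
      unfolding \<pi>(3) by (rule assembly_class_permute[OF F f' \<pi>(2)])
    also have "\<dots> = t"
      unfolding t by (intro assembly_class_cong) (auto simp: \<pi>(4,5) sort_perms_fst[OF \<pi>(2)])
    finally show ?thesis by simp
  qed
  then show ?thesis
    unfolding comp_sp_def by simp (rule the_equality, use as in blast, blast)
qed

lemma assembly_transport:
  assumes G: "\<And>i. i < k \<Longrightarrow> functorial l (G i)" and U: "label_set l U" and \<sigma>: "relabeling \<sigma> U V"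
    and as: "assembly k F G U n f B g"
  shows "assembly k F G V n f (\<lambda>a. \<sigma> ` B a) (\<lambda>a. transport (G (fst a)) (B a) \<sigma> (g a))"
proof -
  have inj: "inj_on \<sigma> U" and im: "\<sigma> ` U = V"
    using \<sigma> by (auto simp: relabeling_def bij_betw_def)
  have sub: "B a \<subseteq> U" if "a \<in> std k n" for a
    using assembly_block_subset[OF as that] .
  have dis: "disjoint_family_on (\<lambda>a. \<sigma> ` B a) (std k n)"
    unfolding disjoint_family_on_def
  proof (intro ballI impI)
    fix a b assume *: "a \<in> std k n" "b \<in> std k n" "a \<noteq> b"
    then have "B a \<inter> B b = {}"
      using as by (auto simp: assembly_def disjoint_family_on_def)
    then show "\<sigma> ` B a \<inter> \<sigma> ` B b = {}"
      using inj_on_image_Int[OF inj sub[OF *(1)] sub[OF *(2)]] by simp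
  qed
  have "transport (G (fst a)) (B a) \<sigma> (g a) \<in> structs (G (fst a)) (\<sigma> ` B a)" if "a \<in> std k n" for a
    using that as sub[OF that]
    by (intro functorial_closed[OF G[OF fst_std[OF that]]] label_set_subset[OF U] relabeling_subset[OF \<sigma>])
      (auto simp: assembly_def)
  moreover have "(\<Union>a\<in>std k n. \<sigma> ` B a) = V"
    using as im by (auto simp: assembly_def)
  ultimately show ?thesis
    using as dis by (auto simp: assembly_def)
qed

section \<open>Functor laws of the composition\<close>

lemma functorial_comp:
  assumes F: "functorial k F" and G: "\<And>i. i < k \<Longrightarrow> functorial l (G i)"
  shows "functorial l (comp_sp k F G)"
  unfolding functorial_def
proof (intro conjI allI impI ballI)
  fix U V \<sigma> s assume *: "label_set l U" "relabeling \<sigma> U V" "s \<in> structs (comp_sp k F G) U"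
  then obtain n f B g where as: "assembly k F G U n f B g" and s: "s = assembly_class k F n f B g"
    by (auto simp: structs_comp)
  show "transport (comp_sp k F G) U \<sigma> s \<in> structs (comp_sp k F G) V"
    unfolding s transport_comp[OF F label_set_finite[OF *(1)] as] structs_comp
    using assembly_transport[OF G *(1,2) as] by blast
next
  fix U s and \<sigma> \<tau> :: "label \<Rightarrow> label" assume *: "label_set l U" "\<forall>a\<in>U. \<sigma> a = \<tau> a" "s \<in> structs (comp_sp k F G) U"
  then obtain n f B g where as: "assembly k F G U n f B g" and s: "s = assembly_class k F n f B g"
    by (auto simp: structs_comp)
  show "transport (comp_sp k F G) U \<sigma> s = transport (comp_sp k F G) U \<tau> s"
    unfolding s transport_comp[OF F label_set_finite[OF *(1)] as]
  proof (rule assembly_class_cong)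
    fix a assume a: "a \<in> std k n"
    note sub = assembly_block_subset[OF as a]
    show "\<sigma> ` B a = \<tau> ` B a"
      using sub * by (intro image_cong) auto
    show "transport (G (fst a)) (B a) \<sigma> (g a) = transport (G (fst a)) (B a) \<tau> (g a)"
      using sub * as a
      by (intro functorial_cong[OF G[OF fst_std[OF a]]] label_set_subset[OF *(1)]) (auto simp: assembly_def)
  qed simp
next
  fix U s assume *: "label_set l U" "s \<in> structs (comp_sp k F G) U"
  then obtain n f B g where as: "assembly k F G U n f B g" and s: "s = assembly_class k F n f B g"
    by (auto simp: structs_comp)
  show "transport (comp_sp k F G) U id s = s"
    unfolding s transport_comp[OF F label_set_finite[OF *(1)] as]
  proof (rule assembly_class_cong)
    fix a assume a: "a \<in> std k n"
    note sub = assembly_block_subset[OF as a]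
    show "transport (G (fst a)) (B a) id (g a) = g a"
      using sub * as a
      by (intro functorial_id[OF G[OF fst_std[OF a]]] label_set_subset[OF *(1)]) (auto simp: assembly_def)
  qed simp_all
next
  fix U V W \<sigma> \<tau> s
  assume *: "label_set l U" "relabeling \<sigma> U V" "relabeling \<tau> V W" "s \<in> structs (comp_sp k F G) U"
  then obtain n f B g where as: "assembly k F G U n f B g" and s: "s = assembly_class k F n f B g"
    by (auto simp: structs_comp)
  have V: "finite V"
    using relabeling_label_set[OF *(2,1)] by (rule label_set_finite)
  have as': "assembly k F G V n f (\<lambda>a. \<sigma> ` B a) (\<lambda>a. transport (G (fst a)) (B a) \<sigma> (g a))"
    by (rule assembly_transport[OF G *(1,2) as])
  show "transport (comp_sp k F G) U (\<tau> \<circ> \<sigma>) s =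
      transport (comp_sp k F G) V \<tau> (transport (comp_sp k F G) U \<sigma> s)"
    unfolding s transport_comp[OF F label_set_finite[OF *(1)] as]
      transport_comp[OF F V as']
  proof (rule assembly_class_cong)
    fix a assume a: "a \<in> std k n"
    note sub = assembly_block_subset[OF as a]
    show "(\<tau> \<circ> \<sigma>) ` B a = \<tau> ` \<sigma> ` B a"
      by (rule image_comp[symmetric])
    have "\<sigma> ` B a \<subseteq> V"
      using sub *(2) by (auto simp: relabeling_def bij_betw_def)
    then have "relabeling \<tau> (\<sigma> ` B a) (\<tau> ` \<sigma> ` B a)"
      by (rule relabeling_subset[OF *(3)])
    moreover have "g a \<in> structs (G (fst a)) (B a)"
      using as a by (simp add: assembly_def)
    ultimately show "transport (G (fst a)) (B a) (\<tau> \<circ> \<sigma>) (g a) =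
        transport (G (fst a)) (\<sigma> ` B a) \<tau> (transport (G (fst a)) (B a) \<sigma> (g a))"
      using functorial_compose[OF G[OF fst_std[OF a]] label_set_subset[OF *(1) sub]
          relabeling_subset[OF *(2) sub]] by blast
  qed simp
qed

section \<open>Counting labels by blocks\<close>

lemma card_blocks:
  assumes "assembly k F G U n f B g" "finite U"
  shows "card {x \<in> U. P x} = (\<Sum>a\<in>std k n. card {x \<in> B a. P x})"
proof -
  have "{x \<in> U. P x} = (\<Union>a\<in>std k n. {x \<in> B a. P x})"
    using assms(1) by (auto simp: assembly_def)
  moreover have "card (\<Union>a\<in>std k n. {x \<in> B a. P x}) = (\<Sum>a\<in>std k n. card {x \<in> B a. P x})"
  proof (rule card_UN_disjoint)
    show "\<forall>a\<in>std k n. finite {x \<in> B a. P x}"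
      using assembly_block_finite[OF assms] by simp
    have "B a \<inter> B b = {}" if "a \<in> std k n" "b \<in> std k n" "a \<noteq> b" for a b
      using assms(1) that by (simp add: assembly_def disjoint_family_on_def)
    then show "\<forall>a\<in>std k n. \<forall>b\<in>std k n. a \<noteq> b \<longrightarrow> {x \<in> B a. P x} \<inter> {x \<in> B b. P x} = {}"
      by blast
  qed simp
  ultimately show ?thesis by simp
qed

lemma card_blocks_total:
  "assembly k F G U n f B g \<Longrightarrow> finite U \<Longrightarrow> card U = (\<Sum>a\<in>std k n. card (B a))"
  using card_blocks[where P = "\<lambda>_. True"] by simp

text \<open>The finite sets in \<open>composable\<close> for all totals up to \<open>N\<close> have
  a finite union, so the sizes occurring there have a maximum. An arbitrary \<open>T\<close> is
  first moved to a standard set, with \<open>n\<close> vanishing from \<open>k\<close> on as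
  \<open>composable\<close> requires.\<close>

lemma composable_bound:
  assumes F: "functorial k F" and c: "composable k F G"
  shows "\<exists>M. \<forall>T. label_set k T \<longrightarrow> structs F T \<noteq> {} \<longrightarrow>
           card {a \<in> T. structs (G (fst a)) {} = {}} \<le> N \<longrightarrow> card T \<le> M"
proof -
  define A where "A = {i. i < k \<and> structs (G i) {} = {}}"
  define X where "X N = {(n, f). (\<forall>i\<ge>k. n i = 0) \<and> (\<Sum>i\<in>A. n i) = N \<and> f \<in> structs F (std k n)}" for N
  have fin: "finite (\<Union>N'\<le>N. X N')"
    using c by (auto simp: composable_def X_def A_def)
  define M where "M = Max ((\<lambda>(n, f). card (std k n)) ` (\<Union>N'\<le>N. X N'))"
  have "card T \<le> M" if T: "label_set k T" "structs F T \<noteq> {}"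
    and le: "card {a \<in> T. structs (G (fst a)) {} = {}} \<le> N" for T
  proof -
    define n where "n i = (if i < k then sort_card i T else 0)" for i
    obtain \<sigma> where \<sigma>: "relabeling \<sigma> T (std k n)"
      using relabeling_to_std[OF T(1)] unfolding n_def by blast
    obtain f where f: "f \<in> structs F (std k n)"
      using T functorial_closed[OF F T(1) \<sigma>] by blast
    have "{a \<in> T. structs (G (fst a)) {} = {}} = (\<Union>i\<in>A. {a \<in> T. fst a = i})"
      using T(1) by (auto simp: A_def label_set_def)
    also have "card \<dots> = (\<Sum>i\<in>A. card {a \<in> T. fst a = i})"
      using T(1) by (intro card_UN_disjoint) (auto simp: A_def label_set_def)
    also have "\<dots> = (\<Sum>i\<in>A. n i)"
      by (intro sum.cong) (auto simp: n_def sort_card_def A_def)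
    finally have "(\<Sum>i\<in>A. n i) \<le> N"
      using le by simp
    then have "(n, f) \<in> (\<Union>N'\<le>N. X N')"
      using f by (auto simp: X_def n_def)
    then have "card (std k n) \<in> (\<lambda>(n, f). card (std k n)) ` (\<Union>N'\<le>N. X N')"
      by (rule rev_image_eqI) simp
    then have "card (std k n) \<le> M"
      unfolding M_def by (intro Max_ge finite_imageI fin)
    then show ?thesis
      using relabeling_card[OF \<sigma>] by simp
  qed
  then show ?thesis by blast
qed

section \<open>Sizes in some sorts against sizes in the others\<close>

definition occurs :: "nat \<Rightarrow> species \<Rightarrow> nat set \<Rightarrow> label set \<Rightarrow> bool" where
  "occurs k F P U \<longleftrightarrow> label_set k U \<and> structs F U \<noteq> {} \<and> fst ` U \<subseteq> P"

definition outside :: "nat set \<Rightarrow> label set \<Rightarrow> nat" where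
  "outside E U = card {a \<in> U. fst a \<notin> E}"

text \<open>If sizes are bounded in terms of the number of labels with sorts outside \<open>E\<close>, then linearly so.
  The set \<open>P\<close> of admitted sorts is needed in the induction over compositions, where only
  those sorts matter for which a structure can be substituted at all.\<close>

definition linear_sizes :: "nat \<Rightarrow> species \<Rightarrow> bool" where
  "linear_sizes k F \<longleftrightarrow>
     (\<forall>E P. (\<forall>N. \<exists>M. \<forall>U. occurs k F P U \<longrightarrow> outside E U \<le> N \<longrightarrow> card U \<le> M) \<longrightarrow>
            (\<exists>c. \<forall>U. occurs k F P U \<longrightarrow> card U \<le> c * outside E U + c))"

lemma linear_sizes_bounded:
  assumes "bounded_size F"
  shows "linear_sizes k F"
proof -
  obtain c where "\<And>U. structs F U \<noteq> {} \<Longrightarrow> card U \<le> c"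
    using assms by (auto simp: bounded_size_def)
  then have "\<forall>U. occurs k F P U \<longrightarrow> card U \<le> c * outside E U + c" for P E
    by (auto simp: occurs_def intro: trans_le_add2)
  then show ?thesis
    unfolding linear_sizes_def by blast
qed

text \<open>Either the only sort lies in \<open>E\<close>, so that \<open>outside E U\<close> is
  always 0 and the assumed bound for \<open>N = 0\<close> is a constant, or
  \<open>outside E U\<close> is the whole size.\<close>

lemma linear_sizes_one_sort: "linear_sizes 1 F"
  unfolding linear_sizes_def
proof (intro allI impI)
  fix E P assume *: "\<forall>N. \<exists>M. \<forall>U. occurs 1 F P U \<longrightarrow> outside E U \<le> N \<longrightarrow> card U \<le> M"
  show "\<exists>c. \<forall>U. occurs 1 F P U \<longrightarrow> card U \<le> c * outside E U + c"
  proof (cases "0 \<in> E")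
    case True
    then have o: "outside E U = 0" if "occurs 1 F P U" for U
      using that unfolding outside_def occurs_def label_set_def by (auto intro!: card_eq_0_iff[THEN iffD2])
    obtain M where "\<And>U. occurs 1 F P U \<Longrightarrow> outside E U \<le> 0 \<Longrightarrow> card U \<le> M"
      using * by blast
    then show ?thesis
      using o by (intro exI[of _ M]) simp
  next
    case False
    then have "{a \<in> U. fst a \<notin> E} = U" if "occurs 1 F P U" for U
      using that unfolding occurs_def label_set_def by auto
    then show ?thesis
      by (intro exI[of _ 1]) (simp add: outside_def)
  qed
qed

lemma occurs_iso: "species_iso k F G \<Longrightarrow> occurs k G P U \<Longrightarrow> occurs k F P U"
  unfolding occurs_def species_iso_def bij_betw_def by auto

lemma occurs_iso': "species_iso k F G \<Longrightarrow> occurs k F P U \<Longrightarrow> occurs k G P U"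
  unfolding occurs_def species_iso_def bij_betw_def by auto

lemma linear_sizes_iso: "species_iso k F G \<Longrightarrow> linear_sizes k F \<Longrightarrow> linear_sizes k G"
  using occurs_iso[of k F G] occurs_iso'[of k F G] unfolding linear_sizes_def by metis

text \<open>Taking for \<open>E\<close> the sorts that admit empty blocks turns the finiteness in
  \<open>composable\<close> into a linear bound.\<close>

lemma linear_sizes_composable:
  assumes "linear_sizes k F" "functorial k F" "composable k F G"
  shows "\<exists>c. \<forall>T. label_set k T \<longrightarrow> structs F T \<noteq> {} \<longrightarrow>
           card T \<le> c * card {a \<in> T. structs (G (fst a)) {} = {}} + c"
proof -
  define E where "E = {i. structs (G i) {} \<noteq> {}}"
  have E: "outside E T = card {a \<in> T. structs (G (fst a)) {} = {}}" for T
    by (simp add: outside_def E_def)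
  have "\<exists>M. \<forall>U. occurs k F UNIV U \<longrightarrow> outside E U \<le> N \<longrightarrow> card U \<le> M" for N
    using composable_bound[OF assms(2,3), of N] by (auto simp: occurs_def E)
  then have "\<exists>c. \<forall>U. occurs k F UNIV U \<longrightarrow> card U \<le> c * outside E U + c"
    using assms(1) unfolding linear_sizes_def by blast
  then show ?thesis
    unfolding occurs_def E by auto
qed

text \<open>The sets \<open>V a\<close> may overlap, so disjoint copies are substituted. One
  \<open>U\<close> serves all \<open>E\<close> at once: with \<open>E = {}\<close> the formula
  counts all labels.\<close>

lemma assembly_exists:
  assumes G: "\<And>i. i < k \<Longrightarrow> functorial l (G i)"
    and f: "f \<in> structs F (std k n)"
    and V: "\<And>a. a \<in> std k n \<Longrightarrow> occurs l (G (fst a)) P (V a)"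
  shows "\<exists>U. occurs l (comp_sp k F G) P U \<and> (\<forall>E. outside E U = (\<Sum>a\<in>std k n. outside E (V a)))"
proof -
  \<comment> \<open>The new name encodes the index together with the old label, which makes copies
    for different indices disjoint; the sort is kept.\<close>
  define \<rho> :: "label \<Rightarrow> label \<Rightarrow> label" where "\<rho> a x = (fst x, to_nat (a, x))" for a x
  define B where "B a = \<rho> a ` V a" for a
  define U where "U = (\<Union>a\<in>std k n. B a)"
  have V': "label_set l (V a)" "structs (G (fst a)) (V a) \<noteq> {}" "fst ` V a \<subseteq> P" if "a \<in> std k n" for a
    using V[OF that] by (auto simp: occurs_def)
  have \<rho>: "relabeling (\<rho> a) (V a) (B a)" for a
    by (auto simp: relabeling_def B_def bij_betw_def inj_on_def \<rho>_def)
  have "\<exists>t. t \<in> structs (G (fst a)) (B a)" if a: "a \<in> std k n" for a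
    using functorial_closed[OF G[OF fst_std[OF a]] V'(1)[OF a] \<rho>] V'(2)[OF a] by blast
  then have "\<forall>a. \<exists>t. a \<in> std k n \<longrightarrow> t \<in> structs (G (fst a)) (B a)"
    by blast
  from choice[OF this] obtain g where g: "\<And>a. a \<in> std k n \<Longrightarrow> g a \<in> structs (G (fst a)) (B a)"
    by blast
  have as: "assembly k F G U n f B g"
    using f g by (auto simp: assembly_def U_def disjoint_family_on_def B_def \<rho>_def)
  have lB: "label_set l (B a)" if "a \<in> std k n" for a
    using relabeling_label_set[OF \<rho> V'(1)[OF that]] .
  then have U: "label_set l U"
    by (auto simp: U_def label_set_def)
  have fstB: "fst ` B a = fst ` V a" for a
    by (auto simp: B_def \<rho>_def image_image)
  then have "fst ` U \<subseteq> P"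
    using V'(3) by (auto simp: U_def image_UN fstB)
  moreover have "assembly_class k F n f B g \<in> structs (comp_sp k F G) U"
    using as by (auto simp: structs_comp)
  ultimately have "occurs l (comp_sp k F G) P U"
    using U by (auto simp: occurs_def)
  moreover have "outside E U = (\<Sum>a\<in>std k n. outside E (V a))" for E
    unfolding outside_def card_blocks[OF as label_set_finite[OF U]]
    by (intro sum.cong refl) (rule relabeling_card[OF relabeling_filter[OF \<rho>], symmetric])
  ultimately show ?thesis by blast
qed

lemma outside_empty: "outside {} U = card U"
  by (simp add: outside_def)

lemma occurs_std:
  assumes "functorial k F" "occurs k F P T"
  obtains n \<sigma> where "relabeling \<sigma> T (std k n)" "occurs k F P (std k n)"
proof -
  have T: "label_set k T" "structs F T \<noteq> {}" "fst ` T \<subseteq> P"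
    using assms(2) by (auto simp: occurs_def)
  obtain \<sigma> n where \<sigma>: "relabeling \<sigma> T (std k n)"
    using relabeling_to_std[OF T(1)] by blast
  have "structs F (std k n) \<noteq> {}"
    using functorial_closed[OF assms(1) T(1) \<sigma>] T(2) by blast
  moreover have "fst ` std k n = fst ` T"
  proof -
    have "std k n = \<sigma> ` T" "\<And>a. a \<in> T \<Longrightarrow> fst (\<sigma> a) = fst a"
      using \<sigma> by (auto simp: relabeling_def bij_betw_def)
    then show ?thesis
      by (simp add: image_image)
  qed
  ultimately show ?thesis
    using that[OF \<sigma>] T(3) by (simp add: occurs_def)
qed

lemma relabeling_outside: "relabeling \<sigma> U V \<Longrightarrow> outside E U = outside E V"
  unfolding outside_def by (rule relabeling_card[OF relabeling_filter])

text \<open>Fixed fillings of the other indices transfer the assumed bound to each inner species;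
  filling all indices transfers it to \<open>F\<close>, where \<open>E\<close> is replaced by the
  sorts that can be filled without labels outside \<open>E\<close>. The linear bounds obtained for
  \<open>F\<close> and for the inner species multiply to one for the composition.\<close>

lemma linear_sizes_comp:
  assumes F: "functorial k F" "linear_sizes k F"
    and G: "\<And>i. i < k \<Longrightarrow> functorial l (G i)" "\<And>i. i < k \<Longrightarrow> linear_sizes l (G i)"
    and comp: "composable k F G"
  shows "linear_sizes l (comp_sp k F G)"
  unfolding linear_sizes_def
proof (intro allI impI)
  fix E P
  assume hyp: "\<forall>N. \<exists>M. \<forall>U. occurs l (comp_sp k F G) P U \<longrightarrow> outside E U \<le> N \<longrightarrow> card U \<le> M"
  \<comment> \<open>\<open>Q\<close> holds the sorts that can be filled at all, \<open>Q'\<close>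
    those that in addition occur in an outer structure all of whose sorts can be filled, and
    \<open>D\<close> those that can be filled at no cost outside \<open>E\<close>. Only for sorts in
    \<open>Q'\<close> can an inner structure be completed to a structure of the composition.\<close>
  define Q where "Q = {i. i < k \<and> (\<exists>V. occurs l (G i) P V)}"
  define Q' where "Q' = {i \<in> Q. \<exists>T. occurs k F Q T \<and> i \<in> fst ` T}"
  define D where "D = {i. \<exists>V. occurs l (G i) P V \<and> outside E V = 0}"
  have "\<forall>i. \<exists>V. i \<in> Q \<longrightarrow> occurs l (G i) P V \<and> (i \<in> D \<longrightarrow> outside E V = 0)"
    by (auto simp: Q_def D_def)
  from choice[OF this] obtain V where V: "\<And>i. i \<in> Q \<Longrightarrow> occurs l (G i) P (V i)"
    "\<And>i. i \<in> Q \<Longrightarrow> i \<in> D \<Longrightarrow> outside E (V i) = 0"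
    by blast
  have Q_Q': "occurs k F Q' T" if "occurs k F Q T" for T
    using that by (force simp: occurs_def Q'_def)

  \<comment> \<open>An inner structure on \<open>W\<close> is placed at an index \<open>a0\<close>
    of sort \<open>i\<close>, the other indices being filled by fixed \<open>V\<close>. This raises
    the cost outside \<open>E\<close> by a constant, and the assumed bound on the whole bounds
    \<open>W\<close>.\<close>
  have "\<exists>c. \<forall>W. occurs l (G i) P W \<longrightarrow> card W \<le> c * outside E W + c" if i: "i \<in> Q'" for i
  proof -
    obtain T where "occurs k F Q T" "i \<in> fst ` T"
      using i by (auto simp: Q'_def)
    moreover from occurs_std[OF F(1) this(1)]
    obtain n \<sigma> where \<sigma>: "relabeling \<sigma> T (std k n)" and T: "occurs k F Q (std k n)"
      by blast
    ultimately obtain a0 where a0: "a0 \<in> std k n" "fst a0 = i"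
      unfolding relabeling_def using bij_betw_apply by fastforce
    obtain f where f: "f \<in> structs F (std k n)"
      using T by (auto simp: occurs_def)
    have "\<exists>M. \<forall>W. occurs l (G i) P W \<longrightarrow> outside E W \<le> N \<longrightarrow> card W \<le> M" for N
    proof -
      define N' where "N' = N + (\<Sum>a\<in>std k n - {a0}. outside E (V (fst a)))"
      obtain M where M: "\<And>U. occurs l (comp_sp k F G) P U \<Longrightarrow> outside E U \<le> N' \<Longrightarrow> card U \<le> M"
        using hyp by blast
      have "card W \<le> M" if W: "occurs l (G i) P W" "outside E W \<le> N" for W
      proof -
        define V' where "V' a = (if a = a0 then W else V (fst a))" for a
        have "occurs l (G (fst a)) P (V' a)" if "a \<in> std k n" for a
          using W(1) a0 V(1)[of "fst a"] T that by (auto simp: V'_def occurs_def)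
        from assembly_exists[where F = F and G = G and V = V', OF G(1) f this] obtain U where
          U: "occurs l (comp_sp k F G) P U" "\<And>E. outside E U = (\<Sum>a\<in>std k n. outside E (V' a))"
          by blast
        have "outside E U = outside E W + (\<Sum>a\<in>std k n - {a0}. outside E (V (fst a)))"
          unfolding U(2) using a0 by (simp add: sum.remove[of _ a0] V'_def)
        then have "card U \<le> M"
          using W(2) by (intro M U(1)) (simp add: N'_def)
        moreover have "card W \<le> card U"
          using U(2)[of "{}"] a0 by (simp add: outside_empty sum.remove[of _ a0] V'_def)
        ultimately show ?thesis by simp
      qed
      then show ?thesis by blast
    qed
    moreover have "linear_sizes l (G i)"
      using i G(2) by (simp add: Q'_def Q_def)
    ultimately show ?thesis
      unfolding linear_sizes_def by blast
  qed
  then have "\<forall>i. \<exists>c. i \<in> Q' \<longrightarrow> (\<forall>W. occurs l (G i) P W \<longrightarrow> card W \<le> c * outside E W + c)"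
    by blast
  from choice[OF this] obtain c where
    c: "\<And>i W. i \<in> Q' \<Longrightarrow> occurs l (G i) P W \<Longrightarrow> card W \<le> c i * outside E W + c i"
    by blast
  define C where "C = (\<Sum>i<k. c i)"
  have C: "card W \<le> C * outside E W + C" if "i \<in> Q'" "occurs l (G i) P W" for i W
  proof -
    have "c i \<le> C"
      using that(1) unfolding C_def by (intro member_le_sum) (auto simp: Q'_def Q_def)
    then show ?thesis
      using c[OF that] by (meson add_mono le_trans mult_le_mono1)
  qed

  \<comment> \<open>Filling every index of \<open>T\<close> by the fixed \<open>V\<close> costs
    nothing in the sorts of \<open>D\<close> and at most \<open>v\<close> elsewhere, so the result
    has bounded size.\<close>
  have "\<exists>M. \<forall>T. occurs k F Q' T \<longrightarrow> outside D T \<le> N \<longrightarrow> card T \<le> M" for N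
  proof -
    define v where "v = (\<Sum>i<k. outside E (V i))"
    obtain M where M: "\<And>U. occurs l (comp_sp k F G) P U \<Longrightarrow> outside E U \<le> N * v \<Longrightarrow> card U \<le> M"
      using hyp by blast
    obtain M' where M': "\<And>T. label_set k T \<Longrightarrow> structs F T \<noteq> {} \<Longrightarrow>
        card {a \<in> T. structs (G (fst a)) {} = {}} \<le> M \<Longrightarrow> card T \<le> M'"
      using composable_bound[OF F(1) comp] by blast
    have "card T \<le> M'" if T: "occurs k F Q' T" "outside D T \<le> N" for T
    proof -
      obtain n \<sigma> where \<sigma>: "relabeling \<sigma> T (std k n)" and n: "occurs k F Q' (std k n)"
        using occurs_std[OF F(1) T(1)] by blast
      have nQ: "fst a \<in> Q" if "a \<in> std k n" for a
        using n that by (auto simp: occurs_def Q'_def)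
      obtain f where f: "f \<in> structs F (std k n)"
        using n by (auto simp: occurs_def)
      have "occurs l (G (fst a)) P (V (fst a))" if "a \<in> std k n" for a
        using V(1) nQ that by blast
      from assembly_exists[where F = F and G = G and V = "\<lambda>a. V (fst a)", OF G(1) f this] obtain U where
        U: "occurs l (comp_sp k F G) P U" "\<And>E. outside E U = (\<Sum>a\<in>std k n. outside E (V (fst a)))"
        by blast
      have "outside E U = (\<Sum>a\<in>{a \<in> std k n. fst a \<notin> D}. outside E (V (fst a)))"
        unfolding U(2) using V(2) nQ by (intro sum.mono_neutral_right) auto
      also have "\<dots> \<le> (\<Sum>a\<in>{a \<in> std k n. fst a \<notin> D}. v)"
        unfolding v_def using fst_std by (intro sum_mono member_le_sum) auto
      also have "\<dots> = outside D (std k n) * v"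
        by (simp add: outside_def)
      also have "\<dots> \<le> N * v"
        using T(2) relabeling_outside[OF \<sigma>] by simp
      finally have "card U \<le> M"
        using M U(1) by blast
      \<comment> \<open>In sorts without empty structures the fillings are nonempty, so the bounded
        size limits the number of these indices, and composability then limits
        \<open>T\<close>.\<close>
      have "card {a \<in> std k n. structs (G (fst a)) {} = {}} =
          (\<Sum>a\<in>{a \<in> std k n. structs (G (fst a)) {} = {}}. 1)"
        by simp
      also have "\<dots> \<le> (\<Sum>a\<in>{a \<in> std k n. structs (G (fst a)) {} = {}}. card (V (fst a)))"
      proof (intro sum_mono)
        fix a assume "a \<in> {a \<in> std k n. structs (G (fst a)) {} = {}}"
        then have "V (fst a) \<noteq> {}" "finite (V (fst a))"
          using V(1)[of "fst a"] nQ[of a] by (auto simp: occurs_def label_set_def)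
        then show "1 \<le> card (V (fst a))"
          by (simp add: Suc_leI card_gt_0_iff)
      qed
      also have "\<dots> \<le> (\<Sum>a\<in>std k n. card (V (fst a)))"
        by (intro sum_mono2) auto
      also have "\<dots> = card U"
        using U(2)[of "{}"] by (simp add: outside_empty)
      finally have "card (std k n) \<le> M'"
        using \<open>card U \<le> M\<close> n by (intro M') (auto simp: occurs_def)
      then show ?thesis
        using relabeling_card[OF \<sigma>] by simp
    qed
    then show ?thesis by blast
  qed
  then have "\<exists>c. \<forall>T. occurs k F Q' T \<longrightarrow> card T \<le> c * outside D T + c"
    using F(2) unfolding linear_sizes_def by blast
  then obtain d where d: "\<And>T. occurs k F Q' T \<Longrightarrow> card T \<le> d * outside D T + d"
    by blast

  have "card U \<le> (C + C * d) * outside E U + (C + C * d)" if U: "occurs l (comp_sp k F G) P U" for U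
  proof -
    have lU: "label_set l U" and PU: "fst ` U \<subseteq> P" and "structs (comp_sp k F G) U \<noteq> {}"
      using U by (auto simp: occurs_def)
    then obtain n f B g where as: "assembly k F G U n f B g"
      by (auto simp: structs_comp)
    have occB: "occurs l (G (fst a)) P (B a)" if a: "a \<in> std k n" for a
      using as a assembly_block_subset[OF as a] PU label_set_subset[OF lU]
      by (auto simp: occurs_def assembly_def)
    have "occurs k F Q (std k n)"
    proof -
      have "fst a \<in> Q" if "a \<in> std k n" for a
        using occB[OF that] fst_std[OF that] by (auto simp: Q_def)
      moreover have "structs F (std k n) \<noteq> {}"
        using as by (auto simp: assembly_def)
      ultimately show ?thesis
        by (auto simp: occurs_def)
    qed
    then have n: "occurs k F Q' (std k n)"
      by (rule Q_Q')
    \<comment> \<open>By the choice of \<open>D\<close>, each index with a sort outside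
      \<open>D\<close> has a block containing a label outside \<open>E\<close>.\<close>
    have "outside D (std k n) = (\<Sum>a\<in>{a \<in> std k n. fst a \<notin> D}. 1)"
      by (simp add: outside_def)
    also have "\<dots> \<le> (\<Sum>a\<in>{a \<in> std k n. fst a \<notin> D}. outside E (B a))"
      using occB by (intro sum_mono) (auto simp: D_def Suc_le_eq)
    also have "\<dots> \<le> (\<Sum>a\<in>std k n. outside E (B a))"
      by (intro sum_mono2) auto
    also have "\<dots> = outside E U"
      unfolding outside_def by (rule card_blocks[OF as label_set_finite[OF lU], symmetric])
    finally have le: "outside D (std k n) \<le> outside E U" .
    have cn: "card (std k n) \<le> d * outside E U + d"
      using d[OF n] le by (meson add_mono le_refl le_trans mult_le_mono2)
    have "card U = (\<Sum>a\<in>std k n. card (B a))"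
      by (rule card_blocks_total[OF as label_set_finite[OF lU]])
    also have "\<dots> \<le> (\<Sum>a\<in>std k n. C * outside E (B a) + C)"
      using C occB n by (intro sum_mono) (auto simp: occurs_def)
    also have "\<dots> = C * (\<Sum>a\<in>std k n. outside E (B a)) + C * card (std k n)"
      by (simp add: sum.distrib sum_distrib_left)
    also have "(\<Sum>a\<in>std k n. outside E (B a)) = outside E U"
      unfolding outside_def by (rule card_blocks[OF as label_set_finite[OF lU], symmetric])
    also have "C * outside E U + C * card (std k n) \<le> C * outside E U + C * (d * outside E U + d)"
      using cn by simp
    also have "\<dots> \<le> (C + C * d) * outside E U + (C + C * d)"
      by (simp add: algebra_simps)
    finally show ?thesis .
  qed
  then show "\<exists>c. \<forall>U. occurs l (comp_sp k F G) P U \<longrightarrow> card U \<le> c * outside E U + c"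
    by blast
qed

section \<open>Codes of isomorphism types\<close>

text \<open>Trees pair and list codes injectively without delimiters. They become bit strings only
  when they are counted.\<close>

datatype bin = Tip | Fork bin bin

primrec bin_size :: "bin \<Rightarrow> nat" where
  "bin_size Tip = 1"
| "bin_size (Fork c d) = 1 + bin_size c + bin_size d"

primrec enc_list :: "bin list \<Rightarrow> bin" where
  "enc_list [] = Tip"
| "enc_list (c # cs) = Fork c (enc_list cs)"

lemma enc_list_inject: "enc_list cs = enc_list ds \<longleftrightarrow> cs = ds"
proof (induction cs arbitrary: ds)
  case Nil
  then show ?case by (cases ds) auto
next
  case (Cons c cs)
  then show ?case by (cases ds) auto
qed

lemma bin_size_enc_list: "bin_size (enc_list cs) = 1 + length cs + sum_list (map bin_size cs)"
  by (induction cs) auto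

text \<open>Unary is short enough: the encoded numbers are sizes, hence at most linear in the number
  of atoms.\<close>

definition enc_nat :: "nat \<Rightarrow> bin" where
  "enc_nat n = enc_list (replicate n Tip)"

lemma enc_nat_inject: "enc_nat m = enc_nat n \<longleftrightarrow> m = n"
  by (auto simp: enc_nat_def enc_list_inject dest: arg_cong[where f = length])

lemma bin_size_enc_nat: "bin_size (enc_nat n) = 2 * n + 1"
  by (simp add: enc_nat_def bin_size_enc_list sum_list_replicate)

text \<open>\<open>R U s c\<close> reads: \<open>c\<close> is a code of the structure
  \<open>s\<close> on \<open>U\<close>. Several codes for one structure are allowed.\<close>

definition separates :: "nat \<Rightarrow> species \<Rightarrow> (label set \<Rightarrow> label struct \<Rightarrow> bin \<Rightarrow> bool) \<Rightarrow> bool" where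
  "separates k F R \<longleftrightarrow>
     (\<forall>U V s t c. label_set k U \<longrightarrow> label_set k V \<longrightarrow> s \<in> structs F U \<longrightarrow> t \<in> structs F V \<longrightarrow>
        R U s c \<longrightarrow> R V t c \<longrightarrow> (\<exists>\<sigma>. relabeling \<sigma> U V \<and> transport F U \<sigma> s = t))"

lemma separatesD:
  "separates k F R \<Longrightarrow> label_set k U \<Longrightarrow> label_set k V \<Longrightarrow> s \<in> structs F U \<Longrightarrow> t \<in> structs F V \<Longrightarrow>
   R U s c \<Longrightarrow> R V t c \<Longrightarrow> \<exists>\<sigma>. relabeling \<sigma> U V \<and> transport F U \<sigma> s = t"
  unfolding separates_def by blast

definition codable :: "nat \<Rightarrow> species \<Rightarrow> bool" where
  "codable k F \<longleftrightarrow>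
     (\<exists>R C. separates k F R \<and>
        (\<forall>U s. label_set k U \<longrightarrow> s \<in> structs F U \<longrightarrow> (\<exists>c. R U s c \<and> bin_size c \<le> C * card U + C)))"

lemma sum_sort_card: "label_set k U \<Longrightarrow> (\<Sum>i<k. sort_card i U) = card U"
proof -
  assume U: "label_set k U"
  have "U = (\<Union>i<k. {a \<in> U. fst a = i})"
    using U by (auto simp: label_set_def)
  also have "card \<dots> = (\<Sum>i<k. card {a \<in> U. fst a = i})"
    using U by (intro card_UN_disjoint) (auto simp: label_set_def)
  finally show ?thesis
    by (simp add: sort_card_def)
qed

lemma codable_one_type_per_profile:
  assumes "one_type_per_profile k F"
  shows "codable k F"
proof -
  define p where "p U = enc_list (map (\<lambda>i. enc_nat (sort_card i U)) [0..<k])" for U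
  have "\<forall>i<k. sort_card i U = sort_card i V" if "p U = p V" for U V
    using that by (auto simp: p_def enc_list_inject enc_nat_inject)
  then have "separates k F (\<lambda>U s c. c = p U)"
    using assms unfolding separates_def one_type_per_profile_def by metis
  moreover have "bin_size (p U) \<le> (2 * k + 2) * card U + (2 * k + 2)" if "label_set k U" for U
  proof -
    have "bin_size (p U) = 1 + k + (\<Sum>i\<leftarrow>[0..<k]. 2 * sort_card i U + 1)"
      by (simp add: p_def bin_size_enc_list bin_size_enc_nat comp_def)
    also have "(\<Sum>i\<leftarrow>[0..<k]. 2 * sort_card i U + 1) = (\<Sum>i<k. 2 * sort_card i U + 1)"
      by (simp add: interv_sum_list_conv_sum_set_nat atLeast0LessThan)
    also have "\<dots> = 2 * card U + k"
      using sum_sort_card[OF that] by (simp only: sum.distrib sum_distrib_left[symmetric]) simp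
    also have "1 + k + (2 * card U + k) \<le> (2 * k + 2) * card U + (2 * k + 2)"
      by simp
    finally show ?thesis .
  qed
  ultimately show ?thesis
    unfolding codable_def by blast
qed

text \<open>Codes are moved along the isomorphism unchanged, so size bounds carry over. This form
  serves full isomorphisms as well as those between truncations, which is all that convergence
  gives.\<close>

lemma separates_iso:
  assumes "species_iso k F G" "separates k F R"
  shows "\<exists>R'. separates k G R' \<and>
    (\<forall>U t. label_set k U \<longrightarrow> t \<in> structs G U \<longrightarrow> (\<exists>s\<in>structs F U. \<forall>c. R U s c \<longrightarrow> R' U t c))"
proof -
  obtain \<alpha> where bij: "\<And>U. label_set k U \<Longrightarrow> bij_betw (\<alpha> U) (structs F U) (structs G U)"
    and nat: "\<And>U V \<sigma> s. label_set k U \<Longrightarrow> relabeling \<sigma> U V \<Longrightarrow> s \<in> structs F U \<Longrightarrow>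
      \<alpha> V (transport F U \<sigma> s) = transport G U \<sigma> (\<alpha> U s)"
    using assms(1) unfolding species_iso_def by blast
  define R' where "R' U t c \<longleftrightarrow> (\<exists>s\<in>structs F U. \<alpha> U s = t \<and> R U s c)" for U t c
  have "separates k G R'"
    unfolding separates_def
  proof (intro allI impI)
    fix U V s t c assume *: "label_set k U" "label_set k V" "R' U s c" "R' V t c"
    then obtain s' t' where st: "s' \<in> structs F U" "\<alpha> U s' = s" "R U s' c"
      "t' \<in> structs F V" "\<alpha> V t' = t" "R V t' c"
      by (auto simp: R'_def)
    then obtain \<sigma> where \<sigma>: "relabeling \<sigma> U V" "transport F U \<sigma> s' = t'"
      using separatesD[OF assms(2) *(1,2)] by blast
    have "transport G U \<sigma> s = t"
      using nat[OF *(1) \<sigma>(1) st(1)] \<sigma>(2) st by simp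
    with \<sigma>(1) show "\<exists>\<sigma>. relabeling \<sigma> U V \<and> transport G U \<sigma> s = t" by blast
  qed
  moreover have "\<exists>s\<in>structs F U. \<forall>c. R U s c \<longrightarrow> R' U t c" if "label_set k U" "t \<in> structs G U" for U t
  proof -
    have "t \<in> \<alpha> U ` structs F U"
      using bij[OF that(1)] that(2) by (simp add: bij_betw_def)
    then show ?thesis
      unfolding R'_def by auto
  qed
  ultimately show ?thesis by blast
qed

lemma codable_iso:
  assumes "species_iso k F G" "codable k F"
  shows "codable k G"
proof -
  obtain R C where RC: "separates k F R"
    "\<And>U s. label_set k U \<Longrightarrow> s \<in> structs F U \<Longrightarrow> \<exists>c. R U s c \<and> bin_size c \<le> C * card U + C"
    using assms(2) unfolding codable_def by blast
  obtain R' where R': "separates k G R'"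
    "\<And>U t. label_set k U \<Longrightarrow> t \<in> structs G U \<Longrightarrow> \<exists>s\<in>structs F U. \<forall>c. R U s c \<longrightarrow> R' U t c"
    using separates_iso[OF assms(1) RC(1)] by blast
  have "\<exists>c. R' U t c \<and> bin_size c \<le> C * card U + C" if "label_set k U" "t \<in> structs G U" for U t
    using R'(2)[OF that] RC(2)[OF that(1)] by blast
  with R'(1) show ?thesis
    unfolding codable_def by blast
qed

text \<open>The relations \<open>R p\<close> for different \<open>p\<close> need not be compatible.
  Prefixing the size in unary tells which of them to use, at a cost of
  \<open>2 * card U + 2\<close>.\<close>

lemma codable_sizewise:
  assumes sep: "\<And>p. separates k (card_restrict {..p} F) (R p)"
    and bound: "\<And>U s. label_set k U \<Longrightarrow> s \<in> structs F U \<Longrightarrow>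
      \<exists>c. R (card U) U s c \<and> bin_size c \<le> C * card U + C"
  shows "codable k F"
proof -
  define R' where "R' U s c \<longleftrightarrow> (\<exists>d. c = Fork (enc_nat (card U)) d \<and> R (card U) U s d)" for U s c
  have "separates k F R'"
    unfolding separates_def
  proof (intro allI impI)
    fix U V s t c
    assume *: "label_set k U" "label_set k V" "s \<in> structs F U" "t \<in> structs F V" "R' U s c" "R' V t c"
    then obtain d where d: "card U = card V" "R (card U) U s d" "R (card U) V t d"
      by (auto simp: R'_def enc_nat_inject)
    have "s \<in> structs (card_restrict {..card U} F) U" "t \<in> structs (card_restrict {..card U} F) V"
      using * d by (auto simp: card_restrict_def)
    from separatesD[OF sep *(1,2) this d(2,3)]
    show "\<exists>\<sigma>. relabeling \<sigma> U V \<and> transport F U \<sigma> s = t"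
      by (simp add: card_restrict_def)
  qed
  moreover have "\<exists>c. R' U s c \<and> bin_size c \<le> (C + 2) * card U + (C + 2)"
    if Us: "label_set k U" "s \<in> structs F U" for U s
  proof -
    obtain c where "R (card U) U s c" "bin_size c \<le> C * card U + C"
      using bound[OF Us] by blast
    then show ?thesis
      by (intro exI[of _ "Fork (enc_nat (card U)) c"]) (auto simp: R'_def bin_size_enc_nat)
  qed
  ultimately show ?thesis
    unfolding codable_def by blast
qed

section \<open>Codes of compositions\<close>

text \<open>The order depends on the set alone, so two assemblies over the same indices list their
  block codes alike.\<close>

definition enum :: "label set \<Rightarrow> label list" where
  "enum T = (SOME xs. set xs = T \<and> distinct xs)"

lemma set_enum_distinct: "finite T \<Longrightarrow> set (enum T) = T \<and> distinct (enum T)"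
  unfolding enum_def by (rule someI_ex) (rule finite_distinct_list)

text \<open>Here a code determines the structure itself and not only its isomorphism type, so that
  the list of the codes of the blocks of an assembly can follow a fixed order of the indices.\<close>

definition canonical_coding ::
  "nat \<Rightarrow> species \<Rightarrow> (label set \<Rightarrow> label struct \<Rightarrow> bin \<Rightarrow> bool) \<Rightarrow> nat \<Rightarrow> bool" where
  "canonical_coding k F Q C \<longleftrightarrow>
     (\<forall>T T' f f' c. Q T f c \<longrightarrow> Q T' f' c \<longrightarrow> T = T' \<and> f = f') \<and>
     (\<forall>n. \<forall>f\<in>structs F (std k n). \<exists>\<pi>\<in>sort_perms k n. \<exists>c.
        Q (std k n) (transport F (std k n) \<pi> f) c \<and> bin_size c \<le> C * card (std k n) + C)"

text \<open>Each code selects one pair of a standard set and a structure having that code. Any other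
  structure with the code on a standard set is isomorphic to the selected one; the two standard sets
  then coincide and the isomorphism is a permutation of the indices.\<close>

lemma canonical_coding_exists:
  assumes F: "functorial k F" and c: "codable k F"
  shows "\<exists>Q C. canonical_coding k F Q C"
proof -
  obtain R C where RC: "separates k F R"
    "\<And>U s. label_set k U \<Longrightarrow> s \<in> structs F U \<Longrightarrow> \<exists>c. R U s c \<and> bin_size c \<le> C * card U + C"
    using c unfolding codable_def by blast
  define A where "A c Tf \<longleftrightarrow> (\<exists>n. fst Tf = std k n) \<and> snd Tf \<in> structs F (fst Tf) \<and> R (fst Tf) (snd Tf) c" for c Tf
  define Q where "Q T f c \<longleftrightarrow> (T, f) = (SOME Tf. A c Tf)" for T f c
  have unique: "\<forall>T T' f f' c. Q T f c \<longrightarrow> Q T' f' c \<longrightarrow> T = T' \<and> f = f'"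
    unfolding Q_def by (metis prod.inject)
  have "\<exists>\<pi>\<in>sort_perms k n. \<exists>c.
        Q (std k n) (transport F (std k n) \<pi> f) c \<and> bin_size c \<le> C * card (std k n) + C"
    if f: "f \<in> structs F (std k n)" for n f
  proof -
    obtain c where c: "R (std k n) f c" "bin_size c \<le> C * card (std k n) + C"
      using RC(2)[OF label_set_std f] by blast
    obtain T' f' where Tf: "(SOME Tf. A c Tf) = (T', f')"
      by (cases "SOME Tf. A c Tf")
    have "A c (std k n, f)"
      using c f by (auto simp: A_def)
    then have "A c (T', f')"
      unfolding Tf[symmetric] by (rule someI)
    then obtain n' where T': "T' = std k n'" and f': "f' \<in> structs F (std k n')" "R (std k n') f' c"
      by (auto simp: A_def)
    obtain \<sigma> where \<sigma>: "relabeling \<sigma> (std k n) (std k n')" "transport F (std k n) \<sigma> f = f'"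
      using separatesD[OF RC(1) label_set_std label_set_std f f'(1) c(1) f'(2)] by blast
    have eq: "std k n = std k n'"
      by (rule relabeling_std[OF \<sigma>(1)])
    obtain \<pi> where \<pi>: "\<pi> \<in> sort_perms k n" "\<And>a. a \<in> std k n \<Longrightarrow> \<pi> a = \<sigma> a"
      by (rule relabeling_agrees_sort_perm[OF \<sigma>(1)[folded eq]]) (rule that)
    have "transport F (std k n) \<pi> f = f'"
      using functorial_cong[OF F label_set_std f \<pi>(2)] \<sigma>(2) by simp
    then have "Q (std k n) (transport F (std k n) \<pi> f) c"
      using Tf T' eq by (simp add: Q_def)
    with \<pi>(1) c(2) show ?thesis by blast
  qed
  then have "canonical_coding k F Q C"
    unfolding canonical_coding_def by (intro conjI unique allI ballI)
  then show ?thesis by blast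
qed

definition comp_coding ::
  "nat \<Rightarrow> species \<Rightarrow> (label set \<Rightarrow> label struct \<Rightarrow> bin \<Rightarrow> bool) \<Rightarrow> (nat \<Rightarrow> species) \<Rightarrow>
   (nat \<Rightarrow> label set \<Rightarrow> label struct \<Rightarrow> bin \<Rightarrow> bool) \<Rightarrow> label set \<Rightarrow> label struct \<Rightarrow> bin \<Rightarrow> bool" where
  "comp_coding k F Q G R U s c \<longleftrightarrow>
     (\<exists>n f B g d e. assembly k F G U n f B g \<and> s = assembly_class k F n f B g \<and> Q (std k n) f d \<and>
        (\<forall>a\<in>std k n. R (fst a) (B a) (g a) (e a)) \<and> c = Fork d (enc_list (map e (enum (std k n)))))"

lemma bin_size_comp_coding:
  "bin_size (Fork d (enc_list (map e (enum (std k n))))) =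
   2 + bin_size d + card (std k n) + (\<Sum>a\<in>std k n. bin_size (e a))"
proof -
  have e: "set (enum (std k n)) = std k n" "distinct (enum (std k n))"
    using set_enum_distinct[OF finite_std] by auto
  have "length (enum (std k n)) = card (std k n)"
    using distinct_card[OF e(2)] e(1) by simp
  moreover have "(\<Sum>a\<leftarrow>enum (std k n). bin_size (e a)) = (\<Sum>a\<in>std k n. bin_size (e a))"
    using sum_list_distinct_conv_sum_set[OF e(2), of "\<lambda>a. bin_size (e a)"] e(1) by simp
  ultimately show ?thesis
    by (simp add: bin_size_enc_list comp_def)
qed

lemma relabeling_glue:
  assumes dis: "disjoint_family_on B T" "disjoint_family_on B' T"
    and \<tau>: "\<And>a. a \<in> T \<Longrightarrow> relabeling (\<tau> a) (B a) (B' a)"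
  obtains \<sigma> where "relabeling \<sigma> (\<Union>a\<in>T. B a) (\<Union>a\<in>T. B' a)" "\<And>a x. a \<in> T \<Longrightarrow> x \<in> B a \<Longrightarrow> \<sigma> x = \<tau> a x"
proof -
  define \<sigma> where "\<sigma> x = \<tau> (THE a. a \<in> T \<and> x \<in> B a) x" for x
  have eq: "\<sigma> x = \<tau> a x" if "a \<in> T" "x \<in> B a" for a x
  proof -
    have "(THE a. a \<in> T \<and> x \<in> B a) = a"
      using dis(1) that by (intro the_equality) (auto simp: disjoint_family_on_def)
    then show ?thesis by (simp add: \<sigma>_def)
  qed
  have "bij_betw \<sigma> (B a) (B' a)" if "a \<in> T" for a
    using \<tau>[OF that] eq[OF that] bij_betw_cong[of "B a" \<sigma> "\<tau> a"] by (simp add: relabeling_def)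
  then have "bij_betw \<sigma> (\<Union>a\<in>T. B a) (\<Union>a\<in>T. B' a)"
    by (rule bij_betw_UNION_disjoint[OF dis(2)])
  moreover have "fst (\<sigma> x) = fst x" if "a \<in> T" "x \<in> B a" for a x
    using \<tau>[OF that(1)] eq[OF that] that(2) by (simp add: relabeling_def)
  ultimately have "relabeling \<sigma> (\<Union>a\<in>T. B a) (\<Union>a\<in>T. B' a)"
    by (auto simp: relabeling_def)
  then show ?thesis
    using that eq by blast
qed

text \<open>The first component of the code fixes the index set and the outer structure literally,
  hence also the order of the list, so the block codes agree index by index. The resulting
  isomorphisms of blocks are glued.\<close>

lemma separates_comp_coding:
  assumes F: "functorial k F" and G: "\<And>i. i < k \<Longrightarrow> functorial l (G i)"
    and Q: "canonical_coding k F Q C" and R: "\<And>i. i < k \<Longrightarrow> separates l (G i) (R i)"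
  shows "separates l (comp_sp k F G) (comp_coding k F Q G R)"
  unfolding separates_def
proof (intro allI impI)
  fix U V s t c
  assume lU: "label_set l U" and lV: "label_set l V"
    and "comp_coding k F Q G R U s c" "comp_coding k F Q G R V t c"
  then obtain n f B g d e n' f' B' g' d' e' where
    as: "assembly k F G U n f B g" and s: "s = assembly_class k F n f B g" and
    Qd: "Q (std k n) f d" and e: "\<And>a. a \<in> std k n \<Longrightarrow> R (fst a) (B a) (g a) (e a)" and
    c: "c = Fork d (enc_list (map e (enum (std k n))))" and
    as': "assembly k F G V n' f' B' g'" and t: "t = assembly_class k F n' f' B' g'" and
    Qd': "Q (std k n') f' d'" and e': "\<And>a. a \<in> std k n' \<Longrightarrow> R (fst a) (B' a) (g' a) (e' a)" and
    c': "c = Fork d' (enc_list (map e' (enum (std k n'))))"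
    unfolding comp_coding_def by blast
  have dd: "d = d'"
    using c c' by simp
  have nn: "std k n = std k n'" and ff: "f = f'"
    using Q Qd Qd' unfolding dd canonical_coding_def by blast+
  have ee: "e a = e' a" if "a \<in> std k n" for a
    using c c' that set_enum_distinct[OF finite_std, of k n] by (auto simp: enc_list_inject nn)
  have UB: "U = (\<Union>a\<in>std k n. B a)" and VB: "V = (\<Union>a\<in>std k n. B' a)"
    and dis: "disjoint_family_on B (std k n)" "disjoint_family_on B' (std k n)"
    and g: "\<And>a. a \<in> std k n \<Longrightarrow> g a \<in> structs (G (fst a)) (B a)"
      "\<And>a. a \<in> std k n \<Longrightarrow> g' a \<in> structs (G (fst a)) (B' a)"
    using as as' by (simp_all add: assembly_def nn)
  have lB: "label_set l (B a)" "label_set l (B' a)" if "a \<in> std k n" for a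
    using assembly_block_subset[OF as that] assembly_block_subset[OF as' that[unfolded nn]]
      label_set_subset lU lV by blast+
  have "\<exists>\<tau>. relabeling \<tau> (B a) (B' a) \<and> transport (G (fst a)) (B a) \<tau> (g a) = g' a"
    if a: "a \<in> std k n" for a
    using separatesD[OF R[OF fst_std[OF a]] lB[OF a] g(1)[OF a] g(2)[OF a] e[OF a]]
      e'[OF a[unfolded nn]] ee[OF a] by simp
  then have "\<forall>a. \<exists>\<tau>. a \<in> std k n \<longrightarrow>
      relabeling \<tau> (B a) (B' a) \<and> transport (G (fst a)) (B a) \<tau> (g a) = g' a"
    by blast
  from choice[OF this] obtain \<tau> where
    \<tau>: "\<And>a. a \<in> std k n \<Longrightarrow> relabeling (\<tau> a) (B a) (B' a)"
      "\<And>a. a \<in> std k n \<Longrightarrow> transport (G (fst a)) (B a) (\<tau> a) (g a) = g' a"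
    by blast
  obtain \<sigma> where \<sigma>: "relabeling \<sigma> U V" "\<And>a x. a \<in> std k n \<Longrightarrow> x \<in> B a \<Longrightarrow> \<sigma> x = \<tau> a x"
    using relabeling_glue[OF dis \<tau>(1)] unfolding UB VB by blast
  have "transport (comp_sp k F G) U \<sigma> s = t"
    unfolding s t ff[symmetric] transport_comp[OF F label_set_finite[OF lU] as]
  proof (rule assembly_class_cong[OF nn])
    fix a assume a: "a \<in> std k n"
    have "\<sigma> ` B a = \<tau> a ` B a"
      using \<sigma>(2)[OF a] by simp
    then show "\<sigma> ` B a = B' a"
      using \<tau>(1)[OF a] by (simp add: relabeling_def bij_betw_def)
    show "transport (G (fst a)) (B a) \<sigma> (g a) = g' a"
      using functorial_cong[OF G[OF fst_std[OF a]] lB(1)[OF a] g(1)[OF a] \<sigma>(2)[OF a]] \<tau>(2)[OF a] by simp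
  qed
  with \<sigma>(1) show "\<exists>\<sigma>. relabeling \<sigma> U V \<and> transport (comp_sp k F G) U \<sigma> s = t" by blast
qed

text \<open>The outer structure is moved along \<pi> to the one that carries a code, and the blocks
  are rearranged by the inverse \<theta>, which leaves the class unchanged.\<close>

lemma canonical_assembly:
  assumes F: "functorial k F" and Q: "canonical_coding k F Q C"
    and s: "s \<in> structs (comp_sp k F G) U"
  obtains n f B g d where "assembly k F G U n f B g" "s = assembly_class k F n f B g"
    "Q (std k n) f d" "bin_size d \<le> C * card (std k n) + C"
proof -
  obtain n f B g where as: "assembly k F G U n f B g" and s: "s = assembly_class k F n f B g"
    using s by (auto simp: structs_comp)
  have f: "f \<in> structs F (std k n)"
    using as by (simp add: assembly_def)
  obtain \<pi> d where \<pi>: "\<pi> \<in> sort_perms k n" and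
    d: "Q (std k n) (transport F (std k n) \<pi> f) d" "bin_size d \<le> C * card (std k n) + C"
    using Q f unfolding canonical_coding_def by blast
  obtain \<theta> where \<theta>: "\<theta> \<in> sort_perms k n" "\<theta> \<circ> \<pi> = id" "\<pi> \<circ> \<theta> = id"
    using sort_perm_inverse[OF \<pi>] .
  have "s = assembly_class k F n f ((B \<circ> \<theta>) \<circ> \<pi>) ((g \<circ> \<theta>) \<circ> \<pi>)"
    unfolding s using \<theta>(2) by (simp add: comp_assoc)
  also have "\<dots> = assembly_class k F n (transport F (std k n) \<pi> f) (B \<circ> \<theta>) (g \<circ> \<theta>)"
    by (rule assembly_class_permute[OF F f \<pi>, symmetric])
  finally have s': "s = assembly_class k F n (transport F (std k n) \<pi> f) (B \<circ> \<theta>) (g \<circ> \<theta>)" .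
  have "assembly k F G U n (transport F (std k n) \<pi> f) (B \<circ> \<theta>) (g \<circ> \<theta>)"
    unfolding assembly_def
  proof (intro conjI ballI)
    show "transport F (std k n) \<pi> f \<in> structs F (std k n)"
      by (rule functorial_closed[OF F label_set_std sort_perms_relabeling[OF \<pi>] f])
    have inj: "inj \<theta>"
      using \<theta>(1) by (auto simp: sort_perms_def dest: permutes_inj)
    show "disjoint_family_on (B \<circ> \<theta>) (std k n)"
      unfolding disjoint_family_on_def
    proof (intro ballI impI)
      fix a b assume "a \<in> std k n" "b \<in> std k n" "a \<noteq> b"
      then have "\<theta> a \<in> std k n" "\<theta> b \<in> std k n" "\<theta> a \<noteq> \<theta> b"
        using sort_perms_in[OF \<theta>(1)] inj by (auto dest: injD)
      then show "(B \<circ> \<theta>) a \<inter> (B \<circ> \<theta>) b = {}"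
        using as by (simp add: assembly_def disjoint_family_on_def)
    qed
    have "(\<Union>a\<in>std k n. (B \<circ> \<theta>) a) = (\<Union>a\<in>\<theta> ` std k n. B a)"
      by simp
    then show "(\<Union>a\<in>std k n. (B \<circ> \<theta>) a) = U"
      using as by (simp add: sort_perms_image[OF \<theta>(1)] assembly_def)
    fix a assume "a \<in> std k n"
    then show "(g \<circ> \<theta>) a \<in> structs (G (fst a)) ((B \<circ> \<theta>) a)"
      using as sort_perms_in[OF \<theta>(1)] sort_perms_fst[OF \<theta>(1), of a] unfolding assembly_def
      by (metis comp_apply)
  qed
  then show ?thesis
    using that s' d by blast
qed

text \<open>Each index contributes a bounded overhead even if its block is empty, so the number of
  indices has to be linear in the size. It is, because indices of sorts without empty structures
  have nonempty blocks, which are at most as many as the atoms.\<close>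

lemma codable_comp:
  assumes F: "functorial k F" "codable k F" "linear_sizes k F"
    and G: "\<And>i. i < k \<Longrightarrow> functorial l (G i)" "\<And>i. i < k \<Longrightarrow> codable l (G i)"
    and comp: "composable k F G"
  shows "codable l (comp_sp k F G)"
proof -
  obtain Q C where Q: "canonical_coding k F Q C"
    using canonical_coding_exists[OF F(1,2)] by blast
  have "\<forall>i. \<exists>RD. i < k \<longrightarrow> separates l (G i) (fst RD) \<and>
      (\<forall>U s. label_set l U \<longrightarrow> s \<in> structs (G i) U \<longrightarrow>
         (\<exists>c. fst RD U s c \<and> bin_size c \<le> snd RD * card U + snd RD))"
    using G(2) unfolding codable_def by simp
  from choice[OF this] obtain RD where
    RD: "\<And>i. i < k \<Longrightarrow> separates l (G i) (fst (RD i))"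
     "\<And>i U s. i < k \<Longrightarrow> label_set l U \<Longrightarrow> s \<in> structs (G i) U \<Longrightarrow>
         \<exists>c. fst (RD i) U s c \<and> bin_size c \<le> snd (RD i) * card U + snd (RD i)"
    by blast
  define R where "R i = fst (RD i)" for i
  define D where "D = (\<Sum>i<k. snd (RD i))"
  have D: "\<exists>c. R i U s c \<and> bin_size c \<le> D * card U + D"
    if "i < k" "label_set l U" "s \<in> structs (G i) U" for i U s
  proof -
    have "snd (RD i) \<le> D"
      using that(1) unfolding D_def by (intro member_le_sum) auto
    then have "snd (RD i) * card U + snd (RD i) \<le> D * card U + D"
      by (intro add_mono mult_le_mono1)
    then show ?thesis
      using RD(2)[OF that] by (auto simp: R_def intro: le_trans)
  qed
  obtain d where d: "\<And>T. label_set k T \<Longrightarrow> structs F T \<noteq> {} \<Longrightarrow>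
      card T \<le> d * card {a \<in> T. structs (G (fst a)) {} = {}} + d"
    using linear_sizes_composable[OF F(3,1) comp] by blast
  \<comment> \<open>Each index costs at most \<open>C + 1 + D\<close> and there are at most
    \<open>d * card U + d\<close> of them; each atom costs a further \<open>D\<close>, and
    \<open>2 + C\<close> is paid once.\<close>
  define K where "K = 2 + C + D + (C + 1 + D) * d"
  have "\<exists>c. comp_coding k F Q G R U s c \<and> bin_size c \<le> K * card U + K"
    if U: "label_set l U" and s: "s \<in> structs (comp_sp k F G) U" for U s
  proof -
    obtain n f B g c where as: "assembly k F G U n f B g" and s: "s = assembly_class k F n f B g"
      and c: "Q (std k n) f c" "bin_size c \<le> C * card (std k n) + C"
      using canonical_assembly[OF F(1) Q s] .
    have g: "g a \<in> structs (G (fst a)) (B a)" if "a \<in> std k n" for a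
      using as that by (simp add: assembly_def)
    have "\<exists>c. R (fst a) (B a) (g a) c \<and> bin_size c \<le> D * card (B a) + D" if a: "a \<in> std k n" for a
      by (rule D[OF fst_std[OF a] label_set_subset[OF U assembly_block_subset[OF as a]] g[OF a]])
    then have "\<forall>a. \<exists>c. a \<in> std k n \<longrightarrow> R (fst a) (B a) (g a) c \<and> bin_size c \<le> D * card (B a) + D"
      by blast
    from choice[OF this] obtain e where e: "\<And>a. a \<in> std k n \<Longrightarrow> R (fst a) (B a) (g a) (e a)"
      "\<And>a. a \<in> std k n \<Longrightarrow> bin_size (e a) \<le> D * card (B a) + D"
      by blast
    let ?c = "Fork c (enc_list (map e (enum (std k n))))"
    have cc: "comp_coding k F Q G R U s ?c"
      unfolding comp_coding_def using as s c(1) e(1) by blast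
    have "card {a \<in> std k n. structs (G (fst a)) {} = {}} =
        (\<Sum>a\<in>{a \<in> std k n. structs (G (fst a)) {} = {}}. 1)"
      by simp
    also have "\<dots> \<le> (\<Sum>a\<in>{a \<in> std k n. structs (G (fst a)) {} = {}}. card (B a))"
    proof (intro sum_mono)
      fix a assume "a \<in> {a \<in> std k n. structs (G (fst a)) {} = {}}"
      then have "B a \<noteq> {}" "finite (B a)"
        using g[of a] assembly_block_finite[OF as label_set_finite[OF U]] by auto
      then show "1 \<le> card (B a)"
        by (simp add: Suc_leI card_gt_0_iff)
    qed
    also have "\<dots> \<le> (\<Sum>a\<in>std k n. card (B a))"
      by (intro sum_mono2) auto
    also have "\<dots> = card U"
      by (rule card_blocks_total[OF as label_set_finite[OF U], symmetric])
    finally have le: "card {a \<in> std k n. structs (G (fst a)) {} = {}} \<le> card U" .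
    have "structs F (std k n) \<noteq> {}"
      using as by (auto simp: assembly_def)
    from d[OF label_set_std this] have cn: "card (std k n) \<le> d * card U + d"
      using le by (meson add_le_mono1 le_trans mult_le_mono2)
    have "bin_size ?c = 2 + bin_size c + card (std k n) + (\<Sum>a\<in>std k n. bin_size (e a))"
      by (rule bin_size_comp_coding)
    also have "\<dots> \<le> 2 + (C * card (std k n) + C) + card (std k n) + (\<Sum>a\<in>std k n. D * card (B a) + D)"
      using c(2) e(2) by (intro add_mono sum_mono) auto
    also have "(\<Sum>a\<in>std k n. D * card (B a) + D) = D * card U + card (std k n) * D"
      by (simp add: card_blocks_total[OF as label_set_finite[OF U]] sum.distrib sum_distrib_left)
    also have "2 + (C * card (std k n) + C) + card (std k n) + (D * card U + card (std k n) * D) =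
        2 + C + (C + 1 + D) * card (std k n) + D * card U"
      by (simp add: algebra_simps)
    also have "\<dots> \<le> 2 + C + (C + 1 + D) * (d * card U + d) + D * card U"
      using cn by (intro add_mono mult_le_mono le_refl)
    also have "\<dots> \<le> K * card U + K"
      by (simp add: K_def algebra_simps)
    finally show ?thesis
      using cc by blast
  qed
  moreover have "separates l (comp_sp k F G) (comp_coding k F Q G R)"
    by (rule separates_comp_coding[OF F(1) G(1) Q]) (simp_all add: R_def RD(1))
  ultimately show ?thesis
    unfolding codable_def by blast
qed

section \<open>Iteration of systems\<close>

lemma functorial_zero: "functorial k zero_sp"
  by (rule functorial_map_struct) (auto simp: zero_sp_def)

lemma functorial_args: "(\<And>j. j < m \<Longrightarrow> functorial 1 (Z j)) \<Longrightarrow> j < Suc m \<Longrightarrow> functorial 1 (args Z j)"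
  using basic_sort by (auto simp: args_def split: nat.split)

lemma assembly_mono:
  assumes "\<And>i V. structs (G i) V \<subseteq> structs (G' i) V" "assembly k F G U n f B g"
  shows "assembly k F G' U n f B g"
  using assms unfolding assembly_def by blast

lemma args_mono:
  "(\<And>j V. structs (Y j) V \<subseteq> structs (Z j) V) \<Longrightarrow> structs (args Y j) V \<subseteq> structs (args Z j) V"
  by (auto simp: args_def split: nat.split)

text \<open>The inclusion is literal, because \<^const>\<open>assembly_class\<close> does not depend on the substituted
  species.\<close>

lemma iter_sp_mono_Suc: "structs (iter_sp m H n i) U \<subseteq> structs (iter_sp m H (Suc n) i) U"
proof (induction n arbitrary: i U)
  case 0
  then show ?case by (simp add: zero_sp_def)
next
  case (Suc n)
  show ?case
  proof
    fix s assume "s \<in> structs (iter_sp m H (Suc n) i) U"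
    then obtain \<nu> f B g where
      as: "assembly (Suc m) (H i) (args (iter_sp m H n)) U \<nu> f B g"
      and s: "s = assembly_class (Suc m) (H i) \<nu> f B g"
      by (auto simp: structs_comp)
    show "s \<in> structs (iter_sp m H (Suc (Suc n)) i) U"
      using assembly_mono[OF args_mono[OF Suc] as] s unfolding iter_sp.simps(2)[of m H "Suc n"] structs_comp
      by blast
  qed
qed

lemma iter_sp_mono: "n \<le> n' \<Longrightarrow> structs (iter_sp m H n i) U \<subseteq> structs (iter_sp m H n' i) U"
  by (rule lift_Suc_mono_le[of "\<lambda>n. structs (iter_sp m H n i) U"]) (rule iter_sp_mono_Suc)

lemma args_iter_sp_mono:
  "n \<le> n' \<Longrightarrow> structs (args (iter_sp m H n) j) U \<subseteq> structs (args (iter_sp m H n') j) U"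
  by (intro args_mono iter_sp_mono)

text \<open>\<open>case_nat\<close> mirrors \<open>args\<close>: a block of sort 0 is a single atom
  with code \<open>Tip\<close>, the others carry codes of the previous level.\<close>

primrec iter_coding ::
  "nat \<Rightarrow> (nat \<Rightarrow> species) \<Rightarrow> (nat \<Rightarrow> label set \<Rightarrow> label struct \<Rightarrow> bin \<Rightarrow> bool) \<Rightarrow> nat \<Rightarrow>
   nat \<Rightarrow> label set \<Rightarrow> label struct \<Rightarrow> bin \<Rightarrow> bool" where
  "iter_coding m H Q 0 = (\<lambda>i U s c. False)"
| "iter_coding m H Q (Suc n) = (\<lambda>i. comp_coding (Suc m) (H i) (Q i) (args (iter_sp m H n))
      (case_nat (\<lambda>U s c. c = Tip) (iter_coding m H Q n)))"

lemma comp_coding_mono: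
  assumes "\<And>i V. structs (G i) V \<subseteq> structs (G' i) V" "\<And>i V s c. R i V s c \<Longrightarrow> R' i V s c"
    "comp_coding k F Q G R U s c"
  shows "comp_coding k F Q G' R' U s c"
  using assms(2,3) assembly_mono[where G = G and G' = G', OF assms(1)]
  unfolding comp_coding_def by blast

lemma iter_coding_mono_Suc: "iter_coding m H Q n i U s c \<Longrightarrow> iter_coding m H Q (Suc n) i U s c"
proof (induction n arbitrary: i U s c)
  case 0
  then show ?case by simp
next
  case (Suc n)
  have *: "case_nat (\<lambda>U s c. c = Tip) (iter_coding m H Q n) j V t d \<Longrightarrow>
      case_nat (\<lambda>U s c. c = Tip) (iter_coding m H Q (Suc n)) j V t d" for j V t d
    using Suc.IH by (cases j) auto
  show ?case
    unfolding iter_coding.simps(2)[of m H Q "Suc n"]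
    by (rule comp_coding_mono[OF args_mono[OF iter_sp_mono_Suc] *])
      (use Suc.prems in \<open>simp_all only: iter_coding.simps(2)\<close>)
qed

lemma iter_coding_mono:
  assumes "n \<le> n'" "iter_coding m H Q n i U s c"
  shows "iter_coding m H Q n' i U s c"
  using assms by (induction n' rule: dec_induct) (auto intro: iter_coding_mono_Suc simp del: iter_coding.simps)

text \<open>Used to bring the finitely many children of a node to one level of the
  iteration.\<close>

lemma eventually_common:
  fixes P :: "'a \<Rightarrow> nat \<Rightarrow> bool"
  assumes "finite A" "\<And>a. a \<in> A \<Longrightarrow> \<exists>n. P a n" "\<And>a n n'. n \<le> n' \<Longrightarrow> P a n \<Longrightarrow> P a n'"
  shows "\<exists>n. \<forall>a\<in>A. P a n"
  using assms(1,2)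
proof (induction A rule: finite_induct)
  case empty
  then show ?case by simp
next
  case (insert x A)
  then obtain n n' where "\<forall>a\<in>A. P a n" "P x n'"
    by blast
  then have "\<forall>a\<in>insert x A. P a (max n n')"
    using assms(3)[of n "max n n'"] assms(3)[of n' "max n n'"] by auto
  then show ?case by blast
qed

text \<open>The data that the induction over constructible species supplies about the right-hand
  sides.\<close>

locale convergent_system =
  fixes m :: nat and H S :: "nat \<Rightarrow> species"
  assumes functorial_H: "\<And>i. i < m \<Longrightarrow> functorial (Suc m) (H i)"
    and linear_H: "\<And>i. i < m \<Longrightarrow> linear_sizes (Suc m) (H i)"
    and codable_H: "\<And>i. i < m \<Longrightarrow> codable (Suc m) (H i)"
    and defined: "iteration_defined m H"
    and limit: "system_limit m H S"
begin

section \<open>Functor laws and stabilization of the iterates\<close>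

abbreviation Y :: "nat \<Rightarrow> nat \<Rightarrow> species" where
  "Y \<equiv> iter_sp m H"

lemma functorial_Y: "i < m \<Longrightarrow> functorial 1 (Y n i)"
proof (induction n arbitrary: i)
  case 0
  then show ?case by (simp add: functorial_zero)
next
  case (Suc n)
  show ?case
    unfolding iter_sp.simps(2)
    by (rule functorial_comp[OF functorial_H[OF Suc.prems] functorial_args[OF Suc.IH]])
qed

lemma functorial_args_Y: "j < Suc m \<Longrightarrow> functorial 1 (args (Y n) j)"
  by (rule functorial_args[OF functorial_Y])

text \<open>The transport of a composition refers to the substituted species, so unlike the
  inclusion of structures, agreement between levels needs an induction through the blocks.\<close>

lemma transport_Y_Suc:
  "i < m \<Longrightarrow> label_set 1 U \<Longrightarrow> s \<in> structs (Y n i) U \<Longrightarrow>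
   transport (Y (Suc n) i) U \<sigma> s = transport (Y n i) U \<sigma> s"
proof (induction n arbitrary: i U s)
  case 0
  then show ?case by (simp add: zero_sp_def)
next
  case (Suc n)
  note fin = label_set_finite[OF Suc.prems(2)] and F = functorial_H[OF Suc.prems(1)]
  obtain \<nu> f B g where
    as: "assembly (Suc m) (H i) (args (Y n)) U \<nu> f B g" and
    s: "s = assembly_class (Suc m) (H i) \<nu> f B g"
    using Suc.prems(3) by (auto simp: structs_comp)
  have as': "assembly (Suc m) (H i) (args (Y (Suc n))) U \<nu> f B g"
    using assembly_mono[OF args_mono[OF iter_sp_mono_Suc] as] .
  show ?case
    unfolding iter_sp.simps(2)[of m H "Suc n"] s transport_comp[OF F fin as']
    unfolding iter_sp.simps(2)[of m H n] transport_comp[OF F fin as]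
    unfolding iter_sp.simps(2)[of m H n, symmetric]
  proof (rule assembly_class_cong)
    fix a assume a: "a \<in> std (Suc m) \<nu>"
    have lB: "label_set 1 (B a)"
      by (rule label_set_subset[OF Suc.prems(2) assembly_block_subset[OF as a]])
    have g: "g a \<in> structs (args (Y n) (fst a)) (B a)"
      using as a by (simp add: assembly_def)
    show "transport (args (Y (Suc n)) (fst a)) (B a) \<sigma> (g a) =
        transport (args (Y n) (fst a)) (B a) \<sigma> (g a)"
    proof (cases "fst a")
      case (Suc j)
      then have "j < m" using fst_std[OF a] by simp
      then show ?thesis
        using Suc.IH[OF _ lB, of j] g Suc by (simp add: args_def del: iter_sp.simps)
    qed (simp add: args_def)
  qed simp_all
qed

lemma transport_Y:
  assumes "n \<le> n'" "i < m" "label_set 1 U" "s \<in> structs (Y n i) U"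
  shows "transport (Y n' i) U \<sigma> s = transport (Y n i) U \<sigma> s"
  using assms(1)
proof (induction n' rule: dec_induct)
  case (step n')
  have "s \<in> structs (Y n' i) U"
    using iter_sp_mono[OF step(1)] assms(4) by blast
  then show ?case
    using transport_Y_Suc[OF assms(2,3)] step by simp
qed simp

text \<open>Late iterates are isomorphic to the same limit up to size \<open>p\<close>, so on each
  \<open>U\<close> they have equally many structures, and finitely many. Being increasing, they are
  literally equal.\<close>

lemma stabilizes:
  "\<exists>N. (\<forall>i<m. species_iso 1 (card_restrict {..p} (Y N i)) (card_restrict {..p} (S i))) \<and>
     (\<forall>n. \<forall>i<m. \<forall>U. label_set 1 U \<longrightarrow> card U \<le> p \<longrightarrow>
        finite (structs (Y n i) U) \<and> structs (Y n i) U \<subseteq> structs (Y N i) U)"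
proof -
  obtain N where N: "\<And>n i. n \<ge> N \<Longrightarrow> i < m \<Longrightarrow>
      species_iso 1 (card_restrict {..p} (Y n i)) (card_restrict {..p} (S i))"
    using limit unfolding system_limit_def eventually_sequentially by blast
  have *: "card (structs (Y n i) U) = card (structs (S i) U) \<and> finite (structs (Y n i) U)"
    if nU: "n \<ge> N" "i < m" "label_set 1 U" and le: "card U \<le> p" for n i U
  proof -
    have "\<exists>\<alpha>. bij_betw \<alpha> (structs (card_restrict {..p} (Y n i)) U)
        (structs (card_restrict {..p} (S i)) U)"
      using N[OF nU(1,2)] nU(3) unfolding species_iso_def by blast
    then obtain \<alpha> where "bij_betw \<alpha> (structs (Y n i) U) (structs (S i) U)"
      using le by (auto simp: card_restrict_def)
    moreover have "finite (structs (S i) U)"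
      using limit nU unfolding system_limit_def is_species_def by blast
    ultimately show ?thesis
      using bij_betw_finite bij_betw_same_card by blast
  qed
  have "finite (structs (Y n i) U) \<and> structs (Y n i) U \<subseteq> structs (Y N i) U"
    if "i < m" "label_set 1 U" "card U \<le> p" for n i U
  proof (cases "n \<le> N")
    case True
    then have "structs (Y n i) U \<subseteq> structs (Y N i) U"
      by (rule iter_sp_mono)
    then show ?thesis
      using *[OF le_refl that] finite_subset by blast
  next
    case False
    then have n: "N \<le> n" by simp
    have "structs (Y N i) U = structs (Y n i) U"
      using *[OF le_refl that] *[OF n that] by (intro card_subset_eq iter_sp_mono[OF n]) auto
    then show ?thesis
      using *[OF n that] by simp
  qed
  with N show ?thesis by blast
qed

text \<open>\<open>(i, j)\<close> is a chain step if a structure of \<open>Y\<^sub>i\<close> can consist of one structure of \<open>Y\<^sub>j\<close> of positive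
  size and of structures on the empty set.\<close>

definition chain_step :: "(nat \<times> nat) set" where
  "chain_step = {(i, j). i < m \<and> j < m \<and>
     (\<exists>U n. label_set 1 U \<and> U \<noteq> {} \<and> structs (Y n j) U \<noteq> {}) \<and>
     (\<exists>\<nu> f a0. f \<in> structs (H i) (std (Suc m) \<nu>) \<and> a0 \<in> std (Suc m) \<nu> \<and> fst a0 = Suc j \<and>
        (\<forall>a\<in>std (Suc m) \<nu> - {a0}. \<exists>n. structs (args (Y n) (fst a)) {} \<noteq> {}))}"

text \<open>The structure \<open>s\<close> is put into a single block that is all of
  \<open>U\<close>, and the remaining blocks are empty. By \<open>assembly_class_eqD\<close> the
  child \<open>s\<close> can be recovered from the resulting class, so if the parent appeared by
  level \<open>Suc h\<close>, then \<open>s\<close> would have appeared by level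
  \<open>h\<close>.\<close>

lemma chain_step_height:
  assumes "(i, j) \<in> chain_step" "label_set 1 U" "s \<in> structs (Y n j) U" "s \<notin> structs (Y h j) U"
  shows "\<exists>n' s'. s' \<in> structs (Y n' i) U \<and> s' \<notin> structs (Y (Suc h) i) U"
proof -
  obtain \<nu> f a0 where im: "i < m" and f: "f \<in> structs (H i) (std (Suc m) \<nu>)" and
    a0: "a0 \<in> std (Suc m) \<nu>" "fst a0 = Suc j" and
    e: "\<And>a. a \<in> std (Suc m) \<nu> - {a0} \<Longrightarrow> \<exists>n. structs (args (Y n) (fst a)) {} \<noteq> {}"
    using assms(1) unfolding chain_step_def by blast
  have "\<exists>n. \<forall>a\<in>std (Suc m) \<nu> - {a0}. structs (args (Y n) (fst a)) {} \<noteq> {}"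
    using e args_iter_sp_mono by (intro eventually_common) (simp, blast, blast)
  then obtain n1 where n1: "\<And>a. a \<in> std (Suc m) \<nu> \<Longrightarrow> a \<noteq> a0 \<Longrightarrow> structs (args (Y n1) (fst a)) {} \<noteq> {}"
    by blast
  define n' where "n' = max n n1"
  have "\<forall>a. \<exists>t. a \<in> std (Suc m) \<nu> \<longrightarrow> a \<noteq> a0 \<longrightarrow> t \<in> structs (args (Y n') (fst a)) {}"
    using n1 args_iter_sp_mono[of n1 n'] unfolding n'_def by fastforce
  from choice[OF this] obtain t where
    t: "\<And>a. a \<in> std (Suc m) \<nu> \<Longrightarrow> a \<noteq> a0 \<Longrightarrow> t a \<in> structs (args (Y n') (fst a)) {}"
    by blast
  define B where "B a = (if a = a0 then U else {})" for a
  define g where "g a = (if a = a0 then s else t a)" for a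
  have "s \<in> structs (Y n' j) U"
    using assms(3) iter_sp_mono[of n n' m H j U] by (auto simp: n'_def)
  then have "g a \<in> structs (args (Y n') (fst a)) (B a)" if "a \<in> std (Suc m) \<nu>" for a
    using t[OF that] a0 by (simp add: g_def B_def args_def)
  moreover have "disjoint_family_on B (std (Suc m) \<nu>)"
    by (simp add: disjoint_family_on_def B_def)
  moreover have "(\<Union>a\<in>std (Suc m) \<nu>. B a) = U"
    using a0 by (auto simp: B_def)
  ultimately have as: "assembly (Suc m) (H i) (args (Y n')) U \<nu> f B g"
    using f by (simp add: assembly_def)
  define s' where "s' = assembly_class (Suc m) (H i) \<nu> f B g"
  have "s' \<in> structs (Y (Suc n') i) U"
    using as by (auto simp: structs_comp s'_def)
  moreover have "s' \<notin> structs (Y (Suc h) i) U"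
  proof
    assume "s' \<in> structs (Y (Suc h) i) U"
    then obtain \<nu>' f' B' g' where
      as': "assembly (Suc m) (H i) (args (Y h)) U \<nu>' f' B' g'" and
      eq: "assembly_class (Suc m) (H i) \<nu> f B g = assembly_class (Suc m) (H i) \<nu>' f' B' g'"
      by (auto simp: structs_comp s'_def)
    note fin = label_set_finite[OF assms(2)]
    obtain \<pi> where \<pi>: "std (Suc m) \<nu> = std (Suc m) \<nu>'" "\<pi> \<in> sort_perms (Suc m) \<nu>'"
      "\<And>a. a \<in> std (Suc m) \<nu>' \<Longrightarrow> B (\<pi> a) = B' a" "\<And>a. a \<in> std (Suc m) \<nu>' \<Longrightarrow> g (\<pi> a) = g' a"
      using assembly_class_eqD[OF functorial_H[OF im] f assembly_block_finite[OF as fin]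
          assembly_block_finite[OF as' fin] eq] by metis
    have "a0 \<in> \<pi> ` std (Suc m) \<nu>'"
      using a0(1) by (simp only: sort_perms_image[OF \<pi>(2)] \<pi>(1))
    then obtain a where a: "a \<in> std (Suc m) \<nu>'" "\<pi> a = a0"
      by (elim imageE) simp
    have "g' a \<in> structs (args (Y h) (fst a)) (B' a)"
      using as' a(1) by (simp add: assembly_def)
    moreover have "fst a = Suc j"
      using sort_perms_fst[OF \<pi>(2) a(1)] a(2) a0(2) by simp
    moreover have "B' a = U" "g' a = s"
      using \<pi>(3,4)[OF a(1)] a(2) by (simp_all add: B_def g_def)
    ultimately show False
      using assms(4) by (simp add: args_def)
  qed
  ultimately show ?thesis by blast
qed

text \<open>A gain of one level is claimed for the whole path, however long; this is all that
  running around a cycle needs.\<close>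

lemma chain_steps_height:
  assumes "(i, j) \<in> chain_step\<^sup>+" "label_set 1 U" "\<exists>n s. s \<in> structs (Y n j) U \<and> s \<notin> structs (Y h j) U"
  shows "\<exists>n s. s \<in> structs (Y n i) U \<and> s \<notin> structs (Y (Suc h) i) U"
  using assms(1)
proof (induction rule: converse_trancl_induct)
  case (base i)
  then show ?case using chain_step_height[OF _ assms(2)] assms(3) by blast
next
  case (step i k)
  then show ?case
    using chain_step_height[OF step(1) assms(2)] iter_sp_mono_Suc by blast
qed

text \<open>Each turn around a cycle delays the first appearance of some structure on the same
  \<open>U\<close>, contradicting the common level of \<open>stabilizes\<close>.\<close>

lemma acyclic_chain_step: "acyclic chain_step"
  unfolding acyclic_def
proof (intro allI notI)
  fix i assume i: "(i, i) \<in> chain_step\<^sup>+"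
  then obtain j where "(j, i) \<in> chain_step"
    by (meson tranclE)
  then obtain U n where im: "i < m" and U: "label_set 1 U" "structs (Y n i) U \<noteq> {}"
    unfolding chain_step_def by blast
  have "\<exists>n s. s \<in> structs (Y n i) U \<and> s \<notin> structs (Y h i) U" for h
  proof (induction h)
    case 0
    then show ?case using U(2) by (auto simp: zero_sp_def)
  next
    case (Suc h)
    then show ?case by (rule chain_steps_height[OF i U(1)])
  qed
  then show False
    using stabilizes[of "card U"] im U(1) by blast
qed

text \<open>A number that drops along every chain step. The \<open>Suc\<close> reserves the value 0
  for atoms.\<close>

definition rank :: "nat \<Rightarrow> nat" where
  "rank i = Suc (card (chain_step\<^sup>+ `` {i}))"

lemma chain_step_subset: "chain_step\<^sup>+ \<subseteq> {..<m} \<times> {..<m}"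
  by (rule trancl_subset_Sigma) (auto simp: chain_step_def)

lemma finite_successors: "finite (chain_step\<^sup>+ `` {i})"
  by (rule finite_subset[of _ "{..<m}"]) (use chain_step_subset in auto)

lemma rank_le: "rank i \<le> Suc m"
proof -
  have "card (chain_step\<^sup>+ `` {i}) \<le> card {..<m}"
    by (rule card_mono) (use chain_step_subset in auto)
  then show ?thesis by (simp add: rank_def)
qed

lemma rank_less:
  assumes "(i, j) \<in> chain_step"
  shows "rank j < rank i"
proof -
  have "chain_step\<^sup>+ `` {j} \<subset> chain_step\<^sup>+ `` {i}"
  proof
    show "chain_step\<^sup>+ `` {j} \<subseteq> chain_step\<^sup>+ `` {i}"
      using assms by (auto intro: trancl_into_trancl2)
    have "j \<in> chain_step\<^sup>+ `` {i}" "j \<notin> chain_step\<^sup>+ `` {j}"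
      using assms acyclic_chain_step by (auto simp: acyclic_def)
    then show "chain_step\<^sup>+ `` {j} \<noteq> chain_step\<^sup>+ `` {i}" by blast
  qed
  then show ?thesis
    unfolding rank_def by (simp add: psubset_card_mono[OF finite_successors])
qed

end

section \<open>Codes of solutions\<close>

lemma separates_sort: "separates 1 (sort_sp 0) (\<lambda>U s c. c = Tip)"
  unfolding separates_def
proof (intro allI impI)
  fix U V s t assume *: "label_set 1 U" "label_set 1 V" "s \<in> structs (sort_sp 0) U" "t \<in> structs (sort_sp 0) V"
  then have "\<forall>i<1. sort_card i U = sort_card i V"
    using sort_card_1[of U] sort_card_1[of V] by (auto simp: sort_sp_def)
  with * show "\<exists>\<sigma>. relabeling \<sigma> U V \<and> transport (sort_sp 0) U \<sigma> s = t"
    using basic_sort[of 1 0] unfolding one_type_per_profile_def by blast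
qed

text \<open>Here \<open>q\<close> nonempty children have total code size \<open>X\<close> and total
  rank \<open>R\<close>, while the node has code size \<open>d\<close>, \<open>p\<close> atoms and
  rank \<open>r\<close>. The overhead \<open>M * q\<close> must be paid by the potential. A single
  child pays by its smaller rank; for two or more, one node keeps only one reserve
  \<open>2 * w\<close> out of \<open>q\<close>, and \<open>(q - 1) * 2 * w\<close> is at least
  \<open>q * w\<close>, hence at least \<open>q + R\<close>.\<close>

lemma potential_step:
  fixes w M q A p R r X d :: nat
  assumes "1 \<le> q" "d \<le> M * q + X" "X + q * (M * (2 * w)) \<le> M * (A * p + R)"
    and R: "R \<le> q * (w - 1)" "q = 1 \<Longrightarrow> R < r" and "1 \<le> w"
  shows "d + M * (2 * w) \<le> M * (A * p + r)"
proof (cases "q = 1")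
  case True
  then have "d + M * (2 * w) \<le> M * (A * p + Suc R)"
    using assms by simp
  also have "\<dots> \<le> M * (A * p + r)"
    using R(2)[OF True] by (intro mult_le_mono2) simp
  finally show ?thesis .
next
  case False
  then have "2 * w \<le> q * w"
    using assms(1) by (intro mult_le_mono1) simp
  moreover have "q * (w - 1) + q = q * w"
    using \<open>1 \<le> w\<close> by (cases w) simp_all
  ultimately have "q + 2 * w + R \<le> q * (2 * w)"
    using R(1) by linarith
  then have "M * (q + 2 * w + R) \<le> M * (q * (2 * w))"
    by (rule mult_le_mono2)
  then show ?thesis
    using assms(2,3) by (simp add: algebra_simps)
qed

locale coded_system = convergent_system +
  fixes Q :: "nat \<Rightarrow> label set \<Rightarrow> label struct \<Rightarrow> bin \<Rightarrow> bool" and C :: nat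
  assumes canonical_Q: "\<And>i. i < m \<Longrightarrow> canonical_coding (Suc m) (H i) (Q i) C"
begin

text \<open>Codes of all levels together: the children of a node may first receive their codes at
  different levels.\<close>

definition R :: "nat \<Rightarrow> label set \<Rightarrow> label struct \<Rightarrow> bin \<Rightarrow> bool" where
  "R i U s c \<longleftrightarrow> (\<exists>n. iter_coding m H Q n i U s c)"

definition R_args :: "nat \<Rightarrow> label set \<Rightarrow> label struct \<Rightarrow> bin \<Rightarrow> bool" where
  "R_args = case_nat (\<lambda>U s c. c = Tip) R"

lemma separates_iter_coding: "i < m \<Longrightarrow> separates 1 (Y n i) (iter_coding m H Q n i)"
proof (induction n arbitrary: i)
  case 0
  then show ?case by (simp add: separates_def)
next
  case (Suc n)
  have *: "separates 1 (args (Y n) j) (case_nat (\<lambda>U s c. c = Tip) (iter_coding m H Q n) j)"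
    if "j < Suc m" for j
    using that Suc.IH separates_sort by (cases j) (simp_all add: args_def)
  show ?case
    unfolding iter_sp.simps(2) iter_coding.simps(2)
    by (rule separates_comp_coding[OF functorial_H[OF Suc.prems] functorial_args_Y canonical_Q[OF Suc.prems] *])
qed

text \<open>Codes from different levels are compared at a common later level, and
  \<open>transport_Y\<close> brings the isomorphism back to level \<open>n\<close>.\<close>

lemma separates_R:
  assumes "i < m"
  shows "separates 1 (Y n i) (R i)"
  unfolding separates_def
proof (intro allI impI)
  fix U V s t c
  assume *: "label_set 1 U" "label_set 1 V" "s \<in> structs (Y n i) U" "t \<in> structs (Y n i) V"
    "R i U s c" "R i V t c"
  then obtain n1 n2 where n12: "iter_coding m H Q n1 i U s c" "iter_coding m H Q n2 i V t c"
    by (auto simp: R_def)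
  define N where "N = Max {n, n1, n2}"
  have N: "n \<le> N" "n1 \<le> N" "n2 \<le> N"
    by (auto simp: N_def)
  have "s \<in> structs (Y N i) U" "t \<in> structs (Y N i) V"
    using *(3,4) iter_sp_mono[OF N(1)] by blast+
  from separatesD[OF separates_iter_coding[OF assms] *(1,2) this
      iter_coding_mono[OF N(2) n12(1)] iter_coding_mono[OF N(3) n12(2)]]
  show "\<exists>\<sigma>. relabeling \<sigma> U V \<and> transport (Y n i) U \<sigma> s = t"
    using transport_Y[OF N(1) assms *(1,3)] by auto
qed

text \<open>The induction step for codes: any codes of the children can be assembled into one of the
  node, once they are lifted to a common level. The assembly itself stays at level \<open>n\<close>,
  where the induction hypothesis applies to its blocks.\<close>

lemma R_node:
  assumes i: "i < m" and s: "s \<in> structs (Y (Suc n) i) U"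
  obtains \<nu> f B g d where "assembly (Suc m) (H i) (args (Y n)) U \<nu> f B g"
    "bin_size d \<le> C * card (std (Suc m) \<nu>) + C"
    "\<And>e. (\<forall>a\<in>std (Suc m) \<nu>. R_args (fst a) (B a) (g a) (e a)) \<Longrightarrow>
       R i U s (Fork d (enc_list (map e (enum (std (Suc m) \<nu>)))))"
proof -
  obtain \<nu> f B g d where as: "assembly (Suc m) (H i) (args (Y n)) U \<nu> f B g" and
    s: "s = assembly_class (Suc m) (H i) \<nu> f B g" and
    d: "Q i (std (Suc m) \<nu>) f d" "bin_size d \<le> C * card (std (Suc m) \<nu>) + C"
    using canonical_assembly[OF functorial_H[OF i] canonical_Q[OF i]] s unfolding iter_sp.simps(2) by blast
  have "R i U s (Fork d (enc_list (map e (enum (std (Suc m) \<nu>)))))"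
    if e: "\<forall>a\<in>std (Suc m) \<nu>. R_args (fst a) (B a) (g a) (e a)" for e
  proof -
    let ?P = "\<lambda>a n. case_nat (\<lambda>U s c. c = Tip) (iter_coding m H Q n) (fst a) (B a) (g a) (e a)"
    have "\<exists>n. \<forall>a\<in>std (Suc m) \<nu>. ?P a n"
    proof (rule eventually_common)
      fix a assume "a \<in> std (Suc m) \<nu>"
      then have "R_args (fst a) (B a) (g a) (e a)"
        using e by blast
      then show "\<exists>n. ?P a n"
        by (cases "fst a") (auto simp: R_args_def R_def)
    next
      fix a n n' assume "n \<le> n'" "?P a n"
      then show "?P a n'"
        using iter_coding_mono[of n n'] by (cases "fst a") auto
    qed simp
    then obtain n1 where n1: "\<And>a. a \<in> std (Suc m) \<nu> \<Longrightarrow> ?P a n1"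
      by blast
    define N where "N = max n n1"
    have "?P a N" if "a \<in> std (Suc m) \<nu>" for a
      using n1[OF that] iter_coding_mono[of n1 N] by (cases "fst a") (auto simp: N_def)
    moreover have "assembly (Suc m) (H i) (args (Y N)) U \<nu> f B g"
      by (rule assembly_mono[OF args_iter_sp_mono as]) (simp add: N_def)
    ultimately have "iter_coding m H Q (Suc N) i U s (Fork d (enc_list (map e (enum (std (Suc m) \<nu>)))))"
      unfolding iter_coding.simps(2) comp_coding_def using s d(1) by blast
    then show ?thesis
      unfolding R_def by blast
  qed
  from that[OF as d(2) this] show ?thesis .
qed

lemma code_exists:
  "i < m \<Longrightarrow> s \<in> structs (Y n i) U \<Longrightarrow> \<exists>c. R i U s c"
proof (induction n arbitrary: i U s)
  case 0
  then show ?case by (simp add: zero_sp_def)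
next
  case (Suc n)
  obtain \<nu> f B g d where as: "assembly (Suc m) (H i) (args (Y n)) U \<nu> f B g" and
    code: "\<And>e. (\<forall>a\<in>std (Suc m) \<nu>. R_args (fst a) (B a) (g a) (e a)) \<Longrightarrow>
       R i U s (Fork d (enc_list (map e (enum (std (Suc m) \<nu>)))))"
    by (rule R_node[OF Suc.prems]) (rule that)
  have "\<exists>c. R_args (fst a) (B a) (g a) c" if a: "a \<in> std (Suc m) \<nu>" for a
  proof (cases "fst a")
    case (Suc j)
    have "g a \<in> structs (args (Y n) (fst a)) (B a)"
      using as a by (simp add: assembly_def)
    moreover have "j < m"
      using fst_std[OF a] Suc by simp
    ultimately show ?thesis
      using Suc.IH[of j "g a" "B a"] Suc by (simp add: args_def R_args_def)
  qed (simp add: R_args_def)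
  then have "\<forall>a. \<exists>c. a \<in> std (Suc m) \<nu> \<longrightarrow> R_args (fst a) (B a) (g a) c"
    by blast
  from choice[OF this] show ?case
    using code by blast
qed

text \<open>On the empty set all levels together have only finitely many structures, so the sum of
  the sizes of one code for each is a bound.\<close>

lemma code_bound_empty:
  "\<exists>K. \<forall>i<m. \<forall>n. \<forall>s\<in>structs (Y n i) {}. \<exists>c. R i {} s c \<and> bin_size c \<le> K"
proof -
  obtain N where N: "\<And>n i. i < m \<Longrightarrow> finite (structs (Y n i) {}) \<and> structs (Y n i) {} \<subseteq> structs (Y N i) {}"
    using stabilizes[of 0] by (auto simp: label_set_def)
  have "\<forall>s. \<forall>i. \<exists>c. i < m \<longrightarrow> s \<in> structs (Y N i) {} \<longrightarrow> R i {} s c"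
    using code_exists by blast
  then obtain c where c: "\<And>i s. i < m \<Longrightarrow> s \<in> structs (Y N i) {} \<Longrightarrow> R i {} s (c s i)"
    by metis
  define K where "K = (\<Sum>i<m. \<Sum>s\<in>structs (Y N i) {}. bin_size (c s i))"
  have "bin_size (c s i) \<le> K" if "i < m" "s \<in> structs (Y N i) {}" for i s
  proof -
    have "bin_size (c s i) \<le> (\<Sum>s\<in>structs (Y N i) {}. bin_size (c s i))"
      using that N by (intro member_le_sum) auto
    also have "\<dots> \<le> K"
      unfolding K_def using that by (intro member_le_sum[of i "{..<m}"]) auto
    finally show ?thesis .
  qed
  then show ?thesis
    using c N by blast
qed

text \<open>Composability is invoked only at a level \<open>N\<close> where the structures on the
  empty set have stabilized, which makes the constant independent of \<open>n\<close>.\<close>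

lemma children_bound:
  "\<exists>D. \<forall>i<m. \<forall>n U \<nu> f B g. label_set 1 U \<longrightarrow> assembly (Suc m) (H i) (args (Y n)) U \<nu> f B g \<longrightarrow>
     card (std (Suc m) \<nu>) \<le> D * card {a \<in> std (Suc m) \<nu>. B a \<noteq> {}} + D"
proof -
  obtain N where N: "\<And>n i. i < m \<Longrightarrow> finite (structs (Y n i) {}) \<and> structs (Y n i) {} \<subseteq> structs (Y N i) {}"
    using stabilizes[of 0] by (auto simp: label_set_def)
  have "\<forall>i. \<exists>c. i < m \<longrightarrow> (\<forall>T. label_set (Suc m) T \<longrightarrow> structs (H i) T \<noteq> {} \<longrightarrow>
      card T \<le> c * card {a \<in> T. structs (args (Y N) (fst a)) {} = {}} + c)"
    using linear_sizes_composable[OF linear_H functorial_H] defined unfolding iteration_defined_def by blast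
  from choice[OF this] obtain c where c: "\<And>i T. i < m \<Longrightarrow> label_set (Suc m) T \<Longrightarrow>
      structs (H i) T \<noteq> {} \<Longrightarrow> card T \<le> c i * card {a \<in> T. structs (args (Y N) (fst a)) {} = {}} + c i"
    by blast
  define D where "D = (\<Sum>i<m. c i)"
  have "card (std (Suc m) \<nu>) \<le> D * card {a \<in> std (Suc m) \<nu>. B a \<noteq> {}} + D"
    if i: "i < m" and as: "assembly (Suc m) (H i) (args (Y n)) U \<nu> f B g" for i n U \<nu> f B g
  proof -
    \<comment> \<open>An empty block carries a structure on the empty set at level \<open>n\<close>,
      hence one at level \<open>N\<close>; for sort 0 there is none.\<close>
    have sub: "{a \<in> std (Suc m) \<nu>. structs (args (Y N) (fst a)) {} = {}} \<subseteq> {a \<in> std (Suc m) \<nu>. B a \<noteq> {}}"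
    proof safe
      fix j x assume a: "(j, x) \<in> std (Suc m) \<nu>" and e: "structs (args (Y N) (fst (j, x))) {} = {}" "B (j, x) = {}"
      have g: "g (j, x) \<in> structs (args (Y n) j) {}"
        using as a e(2) unfolding assembly_def by fastforce
      show False
      proof (cases j)
        case 0
        with g show ?thesis by (simp add: args_def sort_sp_def)
      next
        case (Suc j')
        then have "j' < m" using fst_std[OF a] by simp
        then show ?thesis
          using g e(1) N[of j' n] Suc by (auto simp: args_def)
      qed
    qed
    have "c i \<le> D"
      using i unfolding D_def by (intro member_le_sum) auto
    have "structs (H i) (std (Suc m) \<nu>) \<noteq> {}"
      using as by (auto simp: assembly_def)
    from c[OF i label_set_std this]
    have "card (std (Suc m) \<nu>) \<le>
        c i * card {a \<in> std (Suc m) \<nu>. structs (args (Y N) (fst a)) {} = {}} + c i" .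
    also have "\<dots> \<le> D * card {a \<in> std (Suc m) \<nu>. B a \<noteq> {}} + D"
      using \<open>c i \<le> D\<close> by (intro add_mono mult_le_mono card_mono sub) auto
    finally show ?thesis .
  qed
  then show ?thesis by blast
qed

text \<open>The potential used below is negative without atoms, since ranks are smaller than
  \<open>2 * w\<close>. Structures on the empty set are therefore treated separately by
  \<open>K0\<close>.\<close>

lemma code_bound:
  "\<exists>K. \<forall>i<m. \<forall>n U. \<forall>s\<in>structs (Y n i) U. label_set 1 U \<longrightarrow>
     (\<exists>c. R i U s c \<and> bin_size c \<le> K * card U + K)"
proof -
  obtain K0 where K0: "\<And>i n s. i < m \<Longrightarrow> s \<in> structs (Y n i) {} \<Longrightarrow> \<exists>c. R i {} s c \<and> bin_size c \<le> K0"
    using code_bound_empty by blast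
  obtain D where D: "\<And>i n U \<nu> f B g. i < m \<Longrightarrow> label_set 1 U \<Longrightarrow>
      assembly (Suc m) (H i) (args (Y n)) U \<nu> f B g \<Longrightarrow>
      card (std (Suc m) \<nu>) \<le> D * card {a \<in> std (Suc m) \<nu>. B a \<noteq> {}} + D"
    using children_bound by blast
  \<comment> \<open>\<open>M\<close> is the overhead of a node per nonempty child:
    \<open>2 + C\<close> plus \<open>C + 1 + K0\<close> for each of the at most \<open>2 * D\<close>
    children, empty ones included.\<close>
  define M where "M = 2 + C + (C + 1 + K0) * (2 * D)"
  \<comment> \<open>Ranks of children are at most \<open>Suc m = w - 1\<close>.\<close>
  define w where "w = m + 2"
  \<comment> \<open>An atom has rank 0 and a code of size 1, and needs
    \<open>1 + M * (2 * w) \<le> M * A\<close>.\<close>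
  define A where "A = 2 * w + 1"
  have M1: "1 \<le> M" by (simp add: M_def)
  \<comment> \<open>The potential \<open>M (A |U| - 2 w + rank i)\<close> exceeds the sum of those of the nonempty blocks by at
    least \<open>M\<close> times their number: for one block because the rank decreases, for several blocks because
    of the term \<open>- 2 w\<close>.\<close>
  have main: "\<exists>c. R i U s c \<and> bin_size c + M * (2 * w) \<le> M * (A * card U + rank i)"
    if "i < m" "label_set 1 U" "U \<noteq> {}" "s \<in> structs (Y n i) U" for i U s n
    using that
  proof (induction n arbitrary: i U s)
    case 0
    then show ?case by (simp add: zero_sp_def)
  next
    case (Suc n)
    note im = \<open>i < m\<close> and lU = \<open>label_set 1 U\<close>
    obtain \<nu> f B g d where as: "assembly (Suc m) (H i) (args (Y n)) U \<nu> f B g" and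
      d: "bin_size d \<le> C * card (std (Suc m) \<nu>) + C" and
      code: "\<And>e. (\<forall>a\<in>std (Suc m) \<nu>. R_args (fst a) (B a) (g a) (e a)) \<Longrightarrow>
         R i U s (Fork d (enc_list (map e (enum (std (Suc m) \<nu>)))))"
      by (rule R_node[OF im Suc.prems(4)]) (rule that)
    define T where "T = std (Suc m) \<nu>"
    define T1 where "T1 = {a \<in> T. B a \<noteq> {}}"
    define \<rho> where "\<rho> a = (case fst a of 0 \<Rightarrow> 0 | Suc j \<Rightarrow> rank j)" for a :: label
    have finT: "finite T" "finite T1" "T1 \<subseteq> T"
      by (auto simp: T_def T1_def)
    have lB: "label_set 1 (B a)" if "a \<in> T" for a
      using label_set_subset[OF lU assembly_block_subset[OF as]] that by (simp add: T_def)
    have g: "g a \<in> structs (args (Y n) (fst a)) (B a)" if "a \<in> T" for a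
      using as that by (simp add: assembly_def T_def)
    have "\<exists>c. R_args (fst a) (B a) (g a) c \<and> (B a = {} \<longrightarrow> bin_size c \<le> K0) \<and>
        (B a \<noteq> {} \<longrightarrow> bin_size c + M * (2 * w) \<le> M * (A * card (B a) + \<rho> a))" if a: "a \<in> T" for a
    proof (cases "fst a")
      case 0
      then obtain x where "B a = {(0, x)}"
        using g[OF a] by (auto simp: args_def sort_sp_def)
      then show ?thesis
        using 0 M1 by (intro exI[of _ Tip]) (simp add: R_args_def A_def \<rho>_def)
    next
      case (Suc j)
      then have j: "j < m" using fst_std[of a "Suc m" \<nu>] a by (simp add: T_def)
      have gj: "g a \<in> structs (Y n j) (B a)"
        using g[OF a] Suc by (simp add: args_def)
      show ?thesis
      proof (cases "B a = {}")
        case True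
        then show ?thesis
          using K0[OF j] gj Suc by (simp add: R_args_def)
      next
        case False
        then show ?thesis
          using Suc.IH[OF j lB[OF a] False gj] Suc by (simp add: R_args_def \<rho>_def)
      qed
    qed
    then have "\<forall>a. \<exists>c. a \<in> T \<longrightarrow> R_args (fst a) (B a) (g a) c \<and> (B a = {} \<longrightarrow> bin_size c \<le> K0) \<and>
        (B a \<noteq> {} \<longrightarrow> bin_size c + M * (2 * w) \<le> M * (A * card (B a) + \<rho> a))"
      by blast
    from choice[OF this] obtain e where
      e: "\<And>a. a \<in> T \<Longrightarrow> R_args (fst a) (B a) (g a) (e a)"
      and e0: "\<And>a. a \<in> T \<Longrightarrow> B a = {} \<Longrightarrow> bin_size (e a) \<le> K0"
      and e1: "\<And>a. a \<in> T \<Longrightarrow> B a \<noteq> {} \<Longrightarrow>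
         bin_size (e a) + M * (2 * w) \<le> M * (A * card (B a) + \<rho> a)"
      by blast
    let ?c = "Fork d (enc_list (map e (enum (std (Suc m) \<nu>))))"
    define q where "q = card T1"
    define X where "X = (\<Sum>a\<in>T1. bin_size (e a))"
    have "T1 \<noteq> {}"
      using \<open>U \<noteq> {}\<close> as by (auto simp: assembly_def T1_def T_def)
    then have q: "1 \<le> q"
      using finT by (simp add: q_def Suc_leI card_gt_0_iff)
    have "card T \<le> D * q + D"
      using D[OF im lU as] by (simp add: q_def T1_def T_def)
    \<comment> \<open>A nonempty \<open>U\<close> has a nonempty block, so the additive constant is
      absorbed.\<close>
    also have "\<dots> \<le> 2 * D * q"
      using q by (cases q) auto
    finally have cT: "card T \<le> 2 * D * q" .
    have "(\<Sum>a\<in>T. bin_size (e a)) = (\<Sum>a\<in>T - T1. bin_size (e a)) + X"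
      unfolding X_def using finT by (intro sum.subset_diff) auto
    also have "(\<Sum>a\<in>T - T1. bin_size (e a)) \<le> (\<Sum>a\<in>T - T1. K0)"
      using e0 by (intro sum_mono) (auto simp: T1_def)
    also have "\<dots> \<le> card T * K0"
      using finT by (simp add: card_mono)
    finally have sumT: "(\<Sum>a\<in>T. bin_size (e a)) \<le> card T * K0 + X" by simp
    have "bin_size ?c = 2 + bin_size d + card T + (\<Sum>a\<in>T. bin_size (e a))"
      unfolding T_def by (rule bin_size_comp_coding)
    also have "\<dots> \<le> 2 + (C * card T + C) + card T + (card T * K0 + X)"
      using d sumT by (simp add: T_def)
    also have "\<dots> = (2 + C) + (C + 1 + K0) * card T + X"
      by (simp add: algebra_simps)
    also have "\<dots> \<le> (2 + C) * q + (C + 1 + K0) * (2 * D * q) + X"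
      using cT mult_le_mono2[OF q, of "2 + C"] by (intro add_mono mult_le_mono) auto
    also have "\<dots> = M * q + X"
      by (simp add: M_def algebra_simps)
    finally have c1: "bin_size ?c \<le> M * q + X" .
    have "card U = (\<Sum>a\<in>T. card (B a))"
      unfolding T_def by (rule card_blocks_total[OF as label_set_finite[OF lU]])
    also have "\<dots> = (\<Sum>a\<in>T1. card (B a))"
      using finT by (intro sum.mono_neutral_right) (auto simp: T1_def)
    finally have cU: "card U = (\<Sum>a\<in>T1. card (B a))" .
    have "X + q * (M * (2 * w)) = (\<Sum>a\<in>T1. bin_size (e a) + M * (2 * w))"
      by (simp add: X_def q_def sum.distrib)
    also have "\<dots> \<le> (\<Sum>a\<in>T1. M * (A * card (B a) + \<rho> a))"
      using e1 by (intro sum_mono) (auto simp: T1_def)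
    also have "\<dots> = M * (A * card U + (\<Sum>a\<in>T1. \<rho> a))"
      by (simp add: cU sum.distrib flip: sum_distrib_left)
    finally have c2: "X + q * (M * (2 * w)) \<le> M * (A * card U + (\<Sum>a\<in>T1. \<rho> a))" .
    have "(\<Sum>a\<in>T1. \<rho> a) \<le> (\<Sum>a\<in>T1. w - 1)"
      using rank_le by (intro sum_mono) (auto simp: \<rho>_def w_def split: nat.split)
    then have c3: "(\<Sum>a\<in>T1. \<rho> a) \<le> q * (w - 1)"
      by (simp add: q_def)
    \<comment> \<open>With a single nonempty block, either this block is an atom, of value 0, or the
      node is itself a witness for a chain step, because all other blocks are empty.\<close>
    have c4: "(\<Sum>a\<in>T1. \<rho> a) < rank i" if q1: "q = 1"
    proof -
      obtain a0 where a0: "T1 = {a0}"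
        using q1 unfolding q_def by (rule card_1_singletonE)
      have "a0 \<in> T" "B a0 \<noteq> {}" and other: "\<And>a. a \<in> T \<Longrightarrow> a \<noteq> a0 \<Longrightarrow> B a = {}"
        using a0 by (auto simp: T1_def)
      have "\<rho> a0 < rank i"
      proof (cases "fst a0")
        case 0
        then show ?thesis by (simp add: \<rho>_def rank_def)
      next
        case (Suc j)
        have "j < m" using fst_std[of a0 "Suc m" \<nu>] \<open>a0 \<in> T\<close> Suc by (simp add: T_def)
        moreover have "structs (Y n j) (B a0) \<noteq> {}"
          using g[OF \<open>a0 \<in> T\<close>] Suc by (auto simp: args_def)
        moreover have "f \<in> structs (H i) (std (Suc m) \<nu>)"
          using as by (simp add: assembly_def)
        moreover have "\<forall>a\<in>std (Suc m) \<nu> - {a0}. \<exists>n. structs (args (Y n) (fst a)) {} \<noteq> {}"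
        proof
          fix a assume "a \<in> std (Suc m) \<nu> - {a0}"
          then have "a \<in> T" "a \<noteq> a0" by (auto simp: T_def)
          then have "g a \<in> structs (args (Y n) (fst a)) {}"
            using g[of a] other[of a] by simp
          then show "\<exists>n. structs (args (Y n) (fst a)) {} \<noteq> {}" by blast
        qed
        ultimately have "(i, j) \<in> chain_step"
          unfolding chain_step_def
          using im lB[OF \<open>a0 \<in> T\<close>] \<open>B a0 \<noteq> {}\<close> \<open>a0 \<in> T\<close>[unfolded T_def] Suc by blast
        then show ?thesis
          using rank_less Suc by (simp add: \<rho>_def)
      qed
      then show ?thesis by (simp add: a0)
    qed
    have "bin_size ?c + M * (2 * w) \<le> M * (A * card U + rank i)"
      by (rule potential_step[OF q c1 c2 c3 c4]) (simp_all add: w_def)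
    then show ?case
      using code[of e] e by (auto simp: T_def)
  qed
  define K where "K = K0 + M * A + M * (Suc m)"
  have "\<exists>c. R i U s c \<and> bin_size c \<le> K * card U + K"
    if i: "i < m" and U: "label_set 1 U" and s: "s \<in> structs (Y n i) U" for i n U s
  proof (cases "U = {}")
    case True
    then obtain c where "R i U s c" "bin_size c \<le> K0"
      using K0[OF i] s by blast
    moreover have "K0 \<le> K * card U + K"
      by (simp add: K_def)
    ultimately show ?thesis
      using le_trans by blast
  next
    case False
    obtain c where c: "R i U s c" "bin_size c + M * (2 * w) \<le> M * (A * card U + rank i)"
      using main[OF i U False s] by blast
    have "bin_size c \<le> M * (A * card U + rank i)"
      using c(2) by simp
    also have "\<dots> \<le> M * (A * card U + Suc m)"
      using rank_le by (intro mult_le_mono2) simp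
    also have "\<dots> = (M * A) * card U + M * Suc m"
      by (simp add: algebra_simps)
    also have "\<dots> \<le> K * card U + K"
      unfolding K_def by (intro add_mono mult_le_mono1) auto
    finally show ?thesis
      using c(1) by blast
  qed
  then show ?thesis by blast
qed

text \<open>Up to size \<open>p\<close> the codes come from an iterate isomorphic to the limit. The
  iterate depends on \<open>p\<close>, but the bound \<open>K\<close> does not.\<close>

lemma codable_limit:
  assumes i: "i < m"
  shows "codable 1 (S i)"
proof -
  obtain K where K: "\<And>n U s. label_set 1 U \<Longrightarrow> s \<in> structs (Y n i) U \<Longrightarrow>
      \<exists>c. R i U s c \<and> bin_size c \<le> K * card U + K"
    using code_bound i by blast
  have "\<exists>R'. separates 1 (card_restrict {..p} (S i)) R' \<and>
      (\<forall>U t. label_set 1 U \<longrightarrow> t \<in> structs (card_restrict {..p} (S i)) U \<longrightarrow>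
         (\<exists>c. R' U t c \<and> bin_size c \<le> K * card U + K))" for p
  proof -
    obtain N where iso: "species_iso 1 (card_restrict {..p} (Y N i)) (card_restrict {..p} (S i))"
      using stabilizes[of p] i by blast
    have "separates 1 (card_restrict {..p} (Y N i)) (R i)"
      using separates_R[OF i, of N] unfolding separates_def by (auto simp: card_restrict_def split: if_splits)
    from separates_iso[OF iso this] obtain R' where R': "separates 1 (card_restrict {..p} (S i)) R'"
      "\<And>U t. label_set 1 U \<Longrightarrow> t \<in> structs (card_restrict {..p} (S i)) U \<Longrightarrow>
         \<exists>s\<in>structs (card_restrict {..p} (Y N i)) U. \<forall>c. R i U s c \<longrightarrow> R' U t c"
      by blast
    have "\<exists>c. R' U t c \<and> bin_size c \<le> K * card U + K"
      if Ut: "label_set 1 U" "t \<in> structs (card_restrict {..p} (S i)) U" for U t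
    proof -
      obtain s where s: "s \<in> structs (card_restrict {..p} (Y N i)) U" "\<And>c. R i U s c \<Longrightarrow> R' U t c"
        using R'(2)[OF Ut] by blast
      have "s \<in> structs (Y N i) U"
        using s(1) by (auto simp: card_restrict_def split: if_splits)
      then show ?thesis
        using K[OF Ut(1)] s(2) by blast
    qed
    with R'(1) show ?thesis by blast
  qed
  then have "\<forall>p. \<exists>R'. separates 1 (card_restrict {..p} (S i)) R' \<and>
      (\<forall>U t. label_set 1 U \<longrightarrow> t \<in> structs (card_restrict {..p} (S i)) U \<longrightarrow>
         (\<exists>c. R' U t c \<and> bin_size c \<le> K * card U + K))"
    by blast
  from choice[OF this] obtain R' where R': "\<And>p. separates 1 (card_restrict {..p} (S i)) (R' p)"
    "\<And>p U t. label_set 1 U \<Longrightarrow> t \<in> structs (card_restrict {..p} (S i)) U \<Longrightarrow>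
         \<exists>c. R' p U t c \<and> bin_size c \<le> K * card U + K"
    by blast
  show ?thesis
    by (rule codable_sizewise[of 1 "S i" R' K, OF R'(1)], rule R'(2)) (auto simp: card_restrict_def)
qed

end

lemma (in convergent_system) codable_solution:
  assumes "i < m"
  shows "codable 1 (S i)"
proof -
  have "\<forall>i. \<exists>QC. i < m \<longrightarrow> canonical_coding (Suc m) (H i) (fst QC) (snd QC)"
    using canonical_coding_exists[OF functorial_H codable_H] by simp
  from choice[OF this] obtain QC where
    QC: "\<And>i. i < m \<Longrightarrow> canonical_coding (Suc m) (H i) (fst (QC i)) (snd (QC i))"
    by blast
  define C where "C = (\<Sum>i<m. snd (QC i))"
  have "canonical_coding (Suc m) (H i) (fst (QC i)) C" if i: "i < m" for i
  proof -
    have "snd (QC i) \<le> C"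
      using i unfolding C_def by (intro member_le_sum) auto
    then have *: "snd (QC i) * x + snd (QC i) \<le> C * x + C" for x
      by (intro add_mono mult_le_mono1)
    show ?thesis
      using QC[OF i] unfolding canonical_coding_def by (meson * le_trans)
  qed
  then interpret coded_system m H S "\<lambda>i. fst (QC i)" C
    by unfold_locales
  show ?thesis
    by (rule codable_limit[OF assms])
qed

section \<open>Constructible species\<close>

text \<open>The properties are proved together because codes of a composition rest on linear sizes
  of the outer species. Solutions have one sort, so their linear sizes are immediate.\<close>

lemma constructible_properties:
  "constructible k F \<Longrightarrow> functorial k F \<and> linear_sizes k F \<and> codable k F"
proof (induction rule: constructible.induct)
  case (basic k F)
  then show ?case
    using basic_properties[of k F] linear_sizes_bounded linear_sizes_one_sort codable_one_type_per_profile by blast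
next
  case (basic_card k F I)
  then show ?case
    using basic_properties[of k F] linear_sizes_bounded[OF bounded_size_card_restrict] linear_sizes_one_sort
      codable_one_type_per_profile[OF one_type_per_profile_card_restrict] functorial_card_restrict by blast
next
  case (comp k F l G)
  then show ?case
    using functorial_comp[of k F l G] linear_sizes_comp[of k F l G] codable_comp[of k F l G] by blast
next
  case (solution m H S i)
  interpret convergent_system m H S
    using solution by unfold_locales (auto simp: well_founded_system_def)
  have "is_species 1 (S i)"
    using solution by (simp add: system_limit_def)
  then show ?case
    using is_species_functorial linear_sizes_one_sort codable_solution[OF solution(4)] by blast
next
  case (iso k F G)
  then show ?case
    using is_species_functorial linear_sizes_iso codable_iso by blast
qed

section \<open>Growth of the coefficients\<close>

primrec polish :: "bin \<Rightarrow> bool list" where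
  "polish Tip = [False]"
| "polish (Fork c d) = True # polish c @ polish d"

text \<open>Polish notation is prefix-free. The arbitrary suffixes are what the induction through
  \<open>Fork\<close> needs.\<close>

lemma polish_append_inject: "polish c @ xs = polish d @ ys \<Longrightarrow> c = d \<and> xs = ys"
proof (induction c arbitrary: d xs ys)
  case Tip
  then show ?case by (cases d) auto
next
  case (Fork c1 c2)
  from Fork.prems obtain d1 d2 where d: "d = Fork d1 d2"
    by (cases d) auto
  then have "polish c1 @ (polish c2 @ xs) = polish d1 @ (polish d2 @ ys)"
    using Fork.prems by simp
  then have "c1 = d1" "polish c2 @ xs = polish d2 @ ys"
    using Fork.IH(1) by blast+
  then show ?case
    using Fork.IH(2) d by blast
qed

lemma inj_polish: "inj polish"
  using polish_append_inject[of _ "[]" _ "[]"] by (auto intro: injI)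

lemma length_polish: "length (polish c) = bin_size c"
  by (induction c) auto

lemma card_bins:
  "finite {c. bin_size c \<le> n} \<and> card {c. bin_size c \<le> n} \<le> 2 ^ Suc n"
proof -
  let ?L = "{xs :: bool list. set xs \<subseteq> UNIV \<and> length xs \<le> n}"
  have fin: "finite ?L"
    by (rule finite_lists_length_le) simp
  have "card ?L = (\<Sum>i\<le>n. 2 ^ i)"
    by (subst card_lists_length_le) (simp_all add: card_UNIV_bool)
  also have "\<dots> < 2 ^ Suc n"
    by (induction n) auto
  finally have L: "card ?L \<le> 2 ^ Suc n" by simp
  have sub: "polish ` {c. bin_size c \<le> n} \<subseteq> ?L"
    by (auto simp: length_polish)
  have inj: "inj_on polish {c. bin_size c \<le> n}"
    using inj_polish by (rule inj_on_subset) simp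
  have "card {c. bin_size c \<le> n} \<le> card ?L"
    using card_inj_on_le[OF inj sub fin] .
  then show ?thesis
    using L inj_on_finite[OF inj sub fin] by simp
qed

section \<open>Counting isomorphism types and labelled structures\<close>

lemma equiv_struct_iso:
  assumes F: "functorial 1 F"
  shows "equiv (sized_structures F n) (struct_iso F n)"
proof (rule equivI)
  show "struct_iso F n \<subseteq> sized_structures F n \<times> sized_structures F n"
    by (auto simp: struct_iso_def)
  show "refl_on (sized_structures F n) (struct_iso F n)"
    using functorial_id[OF F]
    by (auto simp: refl_on_def struct_iso_def sized_structures_def intro!: exI[of _ id])
  show "sym (struct_iso F n)"
  proof (rule symI, clarify)
    fix U s V t assume "((U, s), (V, t)) \<in> struct_iso F n"
    then obtain \<sigma> where *: "(U, s) \<in> sized_structures F n" "(V, t) \<in> sized_structures F n"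
      "relabeling \<sigma> U V" "transport F U \<sigma> s = t"
      by (auto simp: struct_iso_def)
    then have "transport F V (inv_into U \<sigma>) t = s"
      using functorial_inverse[OF F _ *(3)] by (auto simp: sized_structures_def)
    then show "((V, t), (U, s)) \<in> struct_iso F n"
      using * relabeling_inv_into[OF *(3)] by (auto simp: struct_iso_def)
  qed
  show "trans (struct_iso F n)"
  proof (rule transI, clarify)
    fix U s V t W u assume "((U, s), (V, t)) \<in> struct_iso F n" "((V, t), (W, u)) \<in> struct_iso F n"
    then obtain \<sigma> \<tau> where *: "(U, s) \<in> sized_structures F n" "(W, u) \<in> sized_structures F n"
      "relabeling \<sigma> U V" "transport F U \<sigma> s = t" "relabeling \<tau> V W" "transport F V \<tau> t = u"
      by (auto simp: struct_iso_def)
    then have "transport F U (\<tau> \<circ> \<sigma>) s = u"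
      using functorial_compose[OF F _ *(3,5)] by (auto simp: sized_structures_def)
    then show "((U, s), (W, u)) \<in> struct_iso F n"
      using * relabeling_compose[OF *(3,5)] by (auto simp: struct_iso_def)
  qed
qed

lemma codable_function:
  assumes "codable k F"
  obtains code C where
    "\<And>U s. label_set k U \<Longrightarrow> s \<in> structs F U \<Longrightarrow> bin_size (code U s) \<le> C * card U + C"
    "\<And>U s V t. label_set k U \<Longrightarrow> label_set k V \<Longrightarrow> s \<in> structs F U \<Longrightarrow> t \<in> structs F V \<Longrightarrow>
       code U s = code V t \<Longrightarrow> \<exists>\<sigma>. relabeling \<sigma> U V \<and> transport F U \<sigma> s = t"
proof -
  obtain R C where sep: "separates k F R" and
    R: "\<And>U s. label_set k U \<Longrightarrow> s \<in> structs F U \<Longrightarrow> \<exists>c. R U s c \<and> bin_size c \<le> C * card U + C"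
    using assms unfolding codable_def by blast
  define code where "code U s = (SOME c. R U s c \<and> bin_size c \<le> C * card U + C)" for U s
  have code: "R U s (code U s) \<and> bin_size (code U s) \<le> C * card U + C"
    if "label_set k U" "s \<in> structs F U" for U s
    unfolding code_def by (rule someI_ex) (rule R[OF that])
  show ?thesis
  proof (rule that)
    show "bin_size (code U s) \<le> C * card U + C" if "label_set k U" "s \<in> structs F U" for U s
      using code[OF that] by simp
    show "\<exists>\<sigma>. relabeling \<sigma> U V \<and> transport F U \<sigma> s = t"
      if *: "label_set k U" "label_set k V" "s \<in> structs F U" "t \<in> structs F V" "code U s = code V t"
      for U s V t
      using separatesD[OF sep *(1-4)] code[OF *(1,3)] code[OF *(2,4)] *(5) by metis
  qed
qed

text \<open>Distinct types have distinct codes. On \<open>{1..n}\<close> the structures with one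
  code form part of a single orbit of the symmetric group, which gives the factor
  \<open>fact n\<close>.\<close>

lemma card_types_le:
  assumes F: "functorial 1 F" "codable 1 F"
  obtains C where "\<And>n. card (sized_structures F n // struct_iso F n) \<le> 2 ^ Suc (C * n + C)"
    "\<And>n. card (structs F (std 1 (\<lambda>_. n))) \<le> fact n * 2 ^ Suc (C * n + C)"
proof -
  obtain code C where
    size: "\<And>U s. label_set 1 U \<Longrightarrow> s \<in> structs F U \<Longrightarrow> bin_size (code U s) \<le> C * card U + C" and
    code: "\<And>U s V t. label_set 1 U \<Longrightarrow> label_set 1 V \<Longrightarrow> s \<in> structs F U \<Longrightarrow> t \<in> structs F V \<Longrightarrow>
       code U s = code V t \<Longrightarrow> \<exists>\<sigma>. relabeling \<sigma> U V \<and> transport F U \<sigma> s = t"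
    by (rule codable_function[OF F(2)]) (rule that)
  define B where "B n = {c. bin_size c \<le> C * n + C}" for n
  have B: "finite (B n)" "card (B n) \<le> 2 ^ Suc (C * n + C)" for n
    using card_bins[of "C * n + C"] by (simp_all add: B_def)
  show ?thesis
  proof (rule that[of C])
    fix n
    let ?X = "sized_structures F n" and ?r = "struct_iso F n"
    define h where "h x = code (fst x) (snd x)" for x
    have hB: "h x \<in> B n" if "x \<in> ?X" for x
      using that size by (auto simp: h_def B_def sized_structures_def)
    have h: "(x, y) \<in> ?r" if "x \<in> ?X" "y \<in> ?X" "h x = h y" for x y
      using that code by (auto simp: h_def struct_iso_def sized_structures_def)
    have rep: "\<exists>x. x \<in> ?X \<and> K = ?r `` {x}" if "K \<in> ?X // ?r" for K
      using that by (auto simp: quotient_def)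
    define pick where "pick K = (SOME x. x \<in> ?X \<and> K = ?r `` {x})" for K
    have pick: "pick K \<in> ?X \<and> K = ?r `` {pick K}" if "K \<in> ?X // ?r" for K
      unfolding pick_def by (rule someI_ex) (rule rep[OF that])
    have "inj_on (h \<circ> pick) (?X // ?r)"
    proof (rule inj_onI)
      fix K L assume KL: "K \<in> ?X // ?r" "L \<in> ?X // ?r" "(h \<circ> pick) K = (h \<circ> pick) L"
      then have "(pick K, pick L) \<in> ?r"
        using h pick by simp
      then have "?r `` {pick K} = ?r `` {pick L}"
        by (rule equiv_class_eq[OF equiv_struct_iso[OF F(1)]])
      then show "K = L"
        using pick KL by metis
    qed
    moreover have "(h \<circ> pick) ` (?X // ?r) \<subseteq> B n"
    proof (rule image_subsetI)
      fix K assume "K \<in> ?X // ?r"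
      then show "(h \<circ> pick) K \<in> B n"
        using hB[of "pick K"] pick by simp
    qed
    ultimately have "card (?X // ?r) \<le> card (B n)"
      using B(1) by (rule card_inj_on_le)
    then show "card (?X // ?r) \<le> 2 ^ Suc (C * n + C)"
      using B(2)[of n] by simp
  next
    fix n
    define T where "T = std 1 (\<lambda>_. n)"
    define Z where "Z = structs F T"
    have lT: "label_set 1 T" by (simp add: T_def)
    have "T = Pair 0 ` {1..n}"
      by (auto simp: T_def std_def)
    then have cT: "card T = n"
      by (simp add: card_image inj_on_def)
    have fT: "finite T" using lT by (rule label_set_finite)
    have fibre: "finite {s \<in> Z. code T s = c} \<and> card {s \<in> Z. code T s = c} \<le> fact n" for c
    proof (cases "{s \<in> Z. code T s = c} = {}")
      case False
      then obtain s0 where s0: "s0 \<in> Z" "code T s0 = c" by blast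
      have "{s \<in> Z. code T s = c} \<subseteq> (\<lambda>\<pi>. transport F T \<pi> s0) ` {\<pi>. \<pi> permutes T}"
      proof
        fix s assume "s \<in> {s \<in> Z. code T s = c}"
        then obtain \<sigma> where \<sigma>: "relabeling \<sigma> T T" "transport F T \<sigma> s0 = s"
          using code[OF lT lT, of s0 s] s0 by (auto simp: Z_def)
        obtain \<pi> where \<pi>: "\<pi> \<in> sort_perms 1 (\<lambda>_. n)" "\<And>a. a \<in> std 1 (\<lambda>_. n) \<Longrightarrow> \<pi> a = \<sigma> a"
          by (rule relabeling_agrees_sort_perm[OF \<sigma>(1)[unfolded T_def]]) (rule that)
        have "transport F T \<pi> s0 = s"
          using functorial_cong[OF F(1) lT _ \<pi>(2)[folded T_def], of s0] s0 \<sigma>(2) by (simp add: Z_def)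
        moreover have "\<pi> permutes T"
          using \<pi>(1) by (simp add: sort_perms_def T_def)
        ultimately show "s \<in> (\<lambda>\<pi>. transport F T \<pi> s0) ` {\<pi>. \<pi> permutes T}" by blast
      qed
      moreover have "finite {\<pi>. \<pi> permutes T}"
        by (rule finite_permutations[OF fT])
      ultimately have "finite {s \<in> Z. code T s = c}"
        "card {s \<in> Z. code T s = c} \<le> card {\<pi>. \<pi> permutes T}"
        using finite_surj surj_card_le by blast+
      then show ?thesis
        using card_permutations[OF cT fT] by simp
    qed (simp only: finite.emptyI card.empty, simp)
    have "Z = (\<Union>c\<in>B n. {s \<in> Z. code T s = c})"
      using size[OF lT] by (auto simp: Z_def B_def cT)
    then have "card Z \<le> (\<Sum>c\<in>B n. card {s \<in> Z. code T s = c})"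
      using card_UN_le[OF B(1)] by metis
    also have "\<dots> \<le> (\<Sum>c\<in>B n. fact n)"
      using fibre by (intro sum_mono) blast
    also have "\<dots> = fact n * card (B n)"
      by simp
    also have "\<dots> \<le> fact n * 2 ^ Suc (C * n + C)"
      using B(2) by (intro mult_le_mono2)
    finally show "card (structs F (std 1 (\<lambda>_. n))) \<le> fact n * 2 ^ Suc (C * n + C)"
      by (simp add: Z_def T_def)
  qed
qed

lemma analytic_near_0I:
  assumes bound: "\<And>n. norm (fps_nth f n) \<le> 2 ^ Suc (C * n + C)"
  shows "analytic_near_0 f"
proof -
  \<comment> \<open>The extra factor 2 beyond the growth rate \<open>2 ^ C\<close> leaves a
    geometric series of ratio 1/2.\<close>
  define r :: real where "r = 1 / 2 ^ Suc C"
  have r: "r > 0" by (simp add: r_def)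
  have sum: "summable (\<lambda>n. fps_nth f n * z ^ n)" if z: "z \<in> ball 0 r" for z
  proof (rule summable_comparison_test')
    show "summable (\<lambda>n. 2 ^ Suc C * (1 / 2 :: real) ^ n)"
      by (intro summable_mult summable_geometric) simp
    fix n :: nat
    have "norm (fps_nth f n * z ^ n) \<le> 2 ^ Suc (C * n + C) * r ^ n"
      unfolding norm_mult norm_power using z r
      by (intro mult_mono bound power_mono) auto
    also have "\<dots> = 2 ^ Suc C * (1 / 2) ^ n"
      by (simp add: r_def power_divide power_add power_mult power_mult_distrib field_simps)
    finally show "norm (fps_nth f n * z ^ n) \<le> 2 ^ Suc C * (1 / 2) ^ n" .
  qed
  have "(\<lambda>z. \<Sum>n. fps_nth f n * z ^ n) analytic_on ball 0 r"
    by (rule power_series_analytic[of 0 r "fps_nth f"]) (use sum in \<open>auto intro: summable_sums\<close>)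
  with r sum show ?thesis
    unfolding analytic_near_0_def by blast
qed

theorem mainTheorem14:
  fixes m :: nat and H :: "nat \<Rightarrow> species"
  assumes constr: "\<And>i. i < m \<Longrightarrow> constructible (Suc m) (H i)"
    and wf: "well_founded_system m H"
  shows "(\<exists>S. system_limit m H S) \<and>
         (\<forall>S. system_limit m H S \<longrightarrow>
            (\<forall>i<m. is_species 1 (S i) \<and> analytic_near_0 (egf (S i)) \<and> analytic_near_0 (ogf (S i))))"
proof (intro conjI allI impI)
  show "\<exists>S. system_limit m H S"
    using wf unfolding well_founded_system_def by blast
next
  fix S i assume lim: "system_limit m H S" and i: "i < m"
  show "is_species 1 (S i)"
    using lim i by (simp add: system_limit_def)
  \<comment> \<open>By rule \<open>solution\<close> the limit is itself constructible, so the given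
    system is treated like one nested inside a construction.\<close>
  have "constructible 1 (S i)"
    by (rule constructible.solution[OF constr wf lim i])
  then have "functorial 1 (S i)" "codable 1 (S i)"
    using constructible_properties by blast+
  then obtain C where
    types: "\<And>n. card (sized_structures (S i) n // struct_iso (S i) n) \<le> 2 ^ Suc (C * n + C)" and
    labelled: "\<And>n. card (structs (S i) (std 1 (\<lambda>_. n))) \<le> fact n * 2 ^ Suc (C * n + C)"
    by (rule card_types_le) (rule that)
  show "analytic_near_0 (ogf (S i))"
  proof (rule analytic_near_0I)
    fix n
    show "norm (fps_nth (ogf (S i)) n) \<le> 2 ^ Suc (C * n + C)"
      using of_nat_mono[OF types[of n], where ?'a = real] by (simp add: ogf_def)
  qed
  show "analytic_near_0 (egf (S i))"
  proof (rule analytic_near_0I)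
    fix n
    have "real (card (structs (S i) (std 1 (\<lambda>_. n)))) \<le> fact n * 2 ^ Suc (C * n + C)"
      using of_nat_mono[OF labelled[of n], where ?'a = real] by simp
    then show "norm (fps_nth (egf (S i)) n) \<le> 2 ^ Suc (C * n + C)"
      by (simp add: egf_def norm_divide divide_le_eq mult.commute)
  qed
qed

end
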